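(* Let $G$ be a second countable, Hausdorff, ample groupoid. Suppose that $G$ is topologically principal and minimal, and that $\mathcal{B}$ is a basis of $G^{(0)}$ consisting of compact open sets. Then $C^*_r(G)$ is purely infinite if and only if every nonzero projection $p$ in $C_0(G^{(0)})$ with $\operatorname{supp}(p)\in\mathcal{B}$ is infinite in $C^*_r(G)$.
   Context: A groupoid $G$ is a small category in which every morphism is invertible; $G^{(0)}$ is its unit space (the identity morphisms), and $r,s:G\to G^{(0)}$ are the range and source maps. A topological groupoid is a groupoid with a topology in which composition is continuous and inversion is a homeomorphism. It is étale if $s$ is a local homeomorphism. An open bisection is an open set $B\subseteq G$ such that $r$ and $s$ restricted to $B$ are homeomorphisms onto open subsets of $G^{(0)}$. A topological groupoid is ample if its topology has a basis of compact open bisections (a Hausdorff ample groupoid is in particular locally compact and étale). $G$ is topologically principal if $\{u\in G^{(0)}: uGu=\{u\}\}$ is dense in $G^{(0)}$, where $uGu=\{\gamma\in G: r(\gamma)=s(\gamma)=u\}$. $G$ is minimal if for every $u\in G^{(0)}$ the set $G\cdot u=\{r(\gamma): s(\gamma)=u\}$ is dense in $G^{(0)}$. For $G$ locally compact, Hausdorff and étale, $C_c(G)$ is a $*$-algebra under $f*g(\gamma)=\sum_{r(\eta)=r(\gamma)}f(\eta)g(\eta^{-1}\gamma)$ and $f^*(\gamma)=\overline{f(\gamma^{-1})}$. For $u\in G^{(0)}$, with $Gu=s^{-1}(u)$, the regular representation $\pi_u$ of $C_c(G)$ on $\ell^2(Gu)$ is given by $\pi_u(f)\delta_\gamma=\sum_{s(\eta)=r(\gamma)}f(\eta)\delta_{\eta\gamma}$.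 The reduced groupoid $C^*$-algebra $C^*_r(G)$ is the completion of $C_c(G)$ in the norm $\|f\|_r=\sup_{u\in G^{(0)}}\|\pi_u(f)\|$. Extension by zero of functions from $G^{(0)}$ to $G$ embeds $C_0(G^{(0)})$ as a $C^*$-subalgebra of $C^*_r(G)$. Let $A$ be a $C^*$-algebra with positive cone $A^+$. For $a,b\in A^+$, write $a\precsim b$ if there is a sequence $x_k\in A$ with $x_k^*bx_k\to a$ in norm. $A$ is purely infinite if there are no characters on $A$ and, for all $a,b\in A^+$, $a\precsim b$ if and only if $a$ lies in $\overline{AbA}$, the closed two-sided ideal generated by $b$. A projection $p\in A$ is infinite if it is Murray–von Neumann equivalent to a proper subprojection of itself, i.e. there is a partial isometry $t\in A$ with $t^*t=p$, $tt^*\le p$ and $tt^*\ne p$. *)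

theory Defs
  imports "HOL-Analysis.Analysis"
begin

section \<open>Groupoids\<close>

text \<open>
  The elements of the type are the morphisms. An object is identified with its identity
  morphism, so range and source are maps from the groupoid to itself.
  The product \<open>mult G x y\<close> is meaningful only when \<open>src G x = rng G y\<close>; no axiom below
  constrains it for other pairs.
\<close>

record 'g groupoid_data =
  rng :: "'g \<Rightarrow> 'g"
  src :: "'g \<Rightarrow> 'g"
  mult :: "'g \<Rightarrow> 'g \<Rightarrow> 'g"
  ginv :: "'g \<Rightarrow> 'g"

definition units :: "'g groupoid_data \<Rightarrow> 'g set" where
  "units G = {u. rng G u = u \<and> src G u = u}"

locale groupoid =
  fixes G :: "'g groupoid_data"
  assumes rng_unit: "rng G x \<in> units G"
    and src_unit: "src G x \<in> units G"
    and rng_mult: "src G x = rng G y \<Longrightarrow> rng G (mult G x y) = rng G x"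
    and src_mult: "src G x = rng G y \<Longrightarrow> src G (mult G x y) = src G y"
    and mult_assoc: "\<lbrakk>src G x = rng G y; src G y = rng G z\<rbrakk>
          \<Longrightarrow> mult G (mult G x y) z = mult G x (mult G y z)"
    and rng_mult_left: "mult G (rng G x) x = x"
    and mult_src_right: "mult G x (src G x) = x"
    and rng_ginv: "rng G (ginv G x) = src G x"
    and src_ginv: "src G (ginv G x) = rng G x"
    and ginv_left: "mult G (ginv G x) x = src G x"
    and ginv_right: "mult G x (ginv G x) = rng G x"

text \<open>
  Continuity of \<open>rng\<close> and \<open>src\<close> is not listed: it follows from continuity of
  multiplication and inversion. The unit space carries the subspace topology.
\<close>

locale topological_groupoid = groupoid G
  for G :: "'g::topological_space groupoid_data" +
  assumes mult_continuous:
      "continuous_on {(x, y). src G x = rng G y} (\<lambda>(x, y). mult G x y)"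
    and ginv_homeomorphism: "\<exists>h. homeomorphism UNIV UNIV (ginv G) h"

definition open_bisection :: "'g::topological_space groupoid_data \<Rightarrow> 'g set \<Rightarrow> bool" where
  "open_bisection G B \<longleftrightarrow> open B
     \<and> openin (top_of_set (units G)) (rng G ` B) \<and> (\<exists>h. homeomorphism B (rng G ` B) (rng G) h)
     \<and> openin (top_of_set (units G)) (src G ` B) \<and> (\<exists>h. homeomorphism B (src G ` B) (src G) h)"

locale ample_groupoid = topological_groupoid G
  for G :: "'g::topological_space groupoid_data" +
  assumes ample: "\<exists>\<B>. topological_basis \<B> \<and> (\<forall>B\<in>\<B>. compact B \<and> open_bisection G B)"

definition topologically_principal :: "'g::topological_space groupoid_data \<Rightarrow> bool" where
  "topologically_principal G \<longleftrightarrow>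
     units G \<subseteq> closure {u \<in> units G. {x. rng G x = u \<and> src G x = u} = {u}}"

definition minimal_groupoid :: "'g::topological_space groupoid_data \<Rightarrow> bool" where
  "minimal_groupoid G \<longleftrightarrow> (\<forall>u\<in>units G. units G \<subseteq> closure {rng G x | x. src G x = u})"

definition compact_open_unit_basis ::
    "'g::topological_space groupoid_data \<Rightarrow> 'g set set \<Rightarrow> bool" where
  "compact_open_unit_basis G \<B> \<longleftrightarrow>
     openin (top_of_set (units G)) = arbitrary union_of (\<lambda>U. U \<in> \<B>) \<and> (\<forall>U\<in>\<B>. compact U)"


section \<open>The convolution algebra and the reduced norm\<close>

definition Cc :: "('g::topological_space \<Rightarrow> complex) set" where
  "Cc = {f. continuous_on UNIV f \<and> compact (closure {x. f x \<noteq> 0})}"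

text \<open>For \<open>f\<close> and \<open>g\<close> in \<^term>\<open>Cc\<close> over an ample Hausdorff groupoid, the sum below has
  only finitely many nonzero terms.\<close>

definition convolution ::
    "'g groupoid_data \<Rightarrow> ('g \<Rightarrow> complex) \<Rightarrow> ('g \<Rightarrow> complex) \<Rightarrow> 'g \<Rightarrow> complex" where
  "convolution G f g =
     (\<lambda>x. \<Sum>\<^sub>\<infinity>y\<in>{y. rng G y = rng G x}. f y * g (mult G (ginv G y) x))"

definition involution :: "'g groupoid_data \<Rightarrow> ('g \<Rightarrow> complex) \<Rightarrow> 'g \<Rightarrow> complex" where
  "involution G f = (\<lambda>x. cnj (f (ginv G x)))"

text \<open>Elements of $\ell^2(S)$ are represented by functions on the whole type vanishing off \<open>S\<close>.\<close>

definition ell2 :: "'g set \<Rightarrow> ('g \<Rightarrow> complex) set" where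
  "ell2 S = {\<xi>. (\<forall>x. x \<notin> S \<longrightarrow> \<xi> x = 0) \<and> (\<lambda>x. (cmod (\<xi> x))\<^sup>2) summable_on S}"

definition ell2_norm :: "'g set \<Rightarrow> ('g \<Rightarrow> complex) \<Rightarrow> real" where
  "ell2_norm S \<xi> = sqrt (\<Sum>\<^sub>\<infinity>x\<in>S. (cmod (\<xi> x))\<^sup>2)"

definition delta :: "'g \<Rightarrow> 'g \<Rightarrow> complex" where
  "delta x = (\<lambda>z. if z = x then 1 else 0)"

definition source_fibre :: "'g groupoid_data \<Rightarrow> 'g \<Rightarrow> 'g set" where
  "source_fibre G u = {x. src G x = u}"

text \<open>
  The inner sum is the vector $\pi_u(f)\delta_x = \sum_{s(y) = r(x)} f(y)\delta_{yx}$, evaluated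
  at \<open>z\<close>; the outer sum extends this linearly and continuously to all
  $\xi = \sum_x \xi(x)\delta_x$ in $\ell^2(Gu)$. For \<open>f\<close> in \<^term>\<open>Cc\<close> over an ample Hausdorff
  groupoid and fixed \<open>z\<close>, both sums have only finitely many nonzero terms.
\<close>

definition regular_rep ::
    "'g groupoid_data \<Rightarrow> 'g \<Rightarrow> ('g \<Rightarrow> complex) \<Rightarrow> ('g \<Rightarrow> complex) \<Rightarrow> 'g \<Rightarrow> complex" where
  "regular_rep G u f \<xi> =
     (\<lambda>z. \<Sum>\<^sub>\<infinity>x\<in>source_fibre G u.
        \<xi> x * (\<Sum>\<^sub>\<infinity>y\<in>{y. src G y = rng G x}. f y * delta (mult G y x) z))"

text \<open>
  Both suprema are taken in the reals. For \<open>f\<close> in \<^term>\<open>Cc\<close> over an ample Hausdorff groupoid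
  they are over nonempty sets bounded above: all $\pi_u(f)$ are bounded by the I-norm of \<open>f\<close>.
\<close>

definition regular_rep_norm :: "'g groupoid_data \<Rightarrow> 'g \<Rightarrow> ('g \<Rightarrow> complex) \<Rightarrow> real" where
  "regular_rep_norm G u f =
     (SUP \<xi>\<in>{\<xi> \<in> ell2 (source_fibre G u). ell2_norm (source_fibre G u) \<xi> \<le> 1}.
        ell2_norm (source_fibre G u) (regular_rep G u f \<xi>))"

definition reduced_norm :: "'g groupoid_data \<Rightarrow> ('g \<Rightarrow> complex) \<Rightarrow> real" where
  "reduced_norm G f = (SUP u\<in>units G. regular_rep_norm G u f)"


section \<open>C*-algebras, not necessarily unital\<close>

class cstar_algebra = real_normed_algebra + banach +
  fixes scaleC :: "complex \<Rightarrow> 'a \<Rightarrow> 'a" (infixr \<open>*\<^sub>C\<close> 75)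
    and star :: "'a \<Rightarrow> 'a"
  assumes scaleC_of_real: "complex_of_real t *\<^sub>C x = t *\<^sub>R x"
    and scaleC_add_right: "c *\<^sub>C (x + y) = c *\<^sub>C x + c *\<^sub>C y"
    and scaleC_add_left: "(c + d) *\<^sub>C x = c *\<^sub>C x + d *\<^sub>C x"
    and scaleC_scaleC: "c *\<^sub>C (d *\<^sub>C x) = (c * d) *\<^sub>C x"
    and mult_scaleC_left: "(c *\<^sub>C x) * y = c *\<^sub>C (x * y)"
    and mult_scaleC_right: "x * (c *\<^sub>C y) = c *\<^sub>C (x * y)"
    and norm_scaleC: "norm (c *\<^sub>C x) = cmod c * norm x"
    and star_add: "star (x + y) = star x + star y"
    and star_scaleC: "star (c *\<^sub>C x) = cnj c *\<^sub>C star x"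
    and star_mult: "star (x * y) = star y * star x"
    and star_star: "star (star x) = x"
    and cstar_identity: "norm (star x * x) = (norm x)\<^sup>2"

definition positive_cone :: "'a::cstar_algebra set" where
  "positive_cone = {star x * x | x. True}"

definition cuntz_below :: "'a::cstar_algebra \<Rightarrow> 'a \<Rightarrow> bool" (infix \<open>\<precsim>\<close> 50) where
  "a \<precsim> b \<longleftrightarrow> (\<exists>x :: nat \<Rightarrow> 'a. (\<lambda>k. star (x k) * b * x k) \<longlonglongrightarrow> a)"

definition closed_two_sided_ideal :: "'a::cstar_algebra set \<Rightarrow> bool" where
  "closed_two_sided_ideal I \<longleftrightarrow> closed I \<and> 0 \<in> I
     \<and> (\<forall>x\<in>I. \<forall>y\<in>I. x + y \<in> I) \<and> (\<forall>c. \<forall>x\<in>I. c *\<^sub>C x \<in> I)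
     \<and> (\<forall>a. \<forall>x\<in>I. a * x \<in> I \<and> x * a \<in> I)"

definition closed_ideal_generated :: "'a::cstar_algebra \<Rightarrow> 'a set" where
  "closed_ideal_generated b = \<Inter>{I. closed_two_sided_ideal I \<and> b \<in> I}"

definition algebra_character :: "('a::cstar_algebra \<Rightarrow> complex) \<Rightarrow> bool" where
  "algebra_character \<phi> \<longleftrightarrow> (\<forall>x y. \<phi> (x + y) = \<phi> x + \<phi> y) \<and> (\<forall>c x. \<phi> (c *\<^sub>C x) = c * \<phi> x)
     \<and> (\<forall>x y. \<phi> (x * y) = \<phi> x * \<phi> y) \<and> (\<exists>x. \<phi> x \<noteq> 0)"

definition purely_infinite :: "'a::cstar_algebra itself \<Rightarrow> bool" where
  "purely_infinite A \<longleftrightarrow> (\<nexists>\<phi> :: 'a \<Rightarrow> complex. algebra_character \<phi>)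
     \<and> (\<forall>a\<in>positive_cone. \<forall>b\<in>positive_cone.
          a \<precsim> b \<longleftrightarrow> a \<in> closed_ideal_generated (b :: 'a))"

definition is_projection :: "'a::cstar_algebra \<Rightarrow> bool" where
  "is_projection p \<longleftrightarrow> star p = p \<and> p * p = p"

definition partial_isometry :: "'a::cstar_algebra \<Rightarrow> bool" where
  "partial_isometry t \<longleftrightarrow> t * star t * t = t"

text \<open>The order is the usual one: $tt^* \le p$ means that $p - tt^*$ is positive.\<close>

definition infinite_projection :: "'a::cstar_algebra \<Rightarrow> bool" where
  "infinite_projection p \<longleftrightarrow> is_projection p
     \<and> (\<exists>t. partial_isometry t \<and> star t * t = p \<and> p - t * star t \<in> positive_cone \<and> t * star t \<noteq> p)"


section \<open>The reduced C*-algebra\<close>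

text \<open>
  The type \<open>'a\<close>, together with the map \<open>\<iota>\<close>, is the completion of the *-algebra \<^term>\<open>Cc\<close> in the
  reduced norm: \<open>\<iota>\<close> is an isometric *-homomorphism with dense image into a complete algebra.
  This determines the pair up to a unique isometric *-isomorphism compatible with \<open>\<iota>\<close>.
  That \<open>'a\<close> satisfies the C*-identity is no extra restriction, as the reduced norm is a
  supremum of operator norms of *-representations on Hilbert spaces.
\<close>

definition reduced_cstar_algebra ::
    "'g::topological_space groupoid_data \<Rightarrow> (('g \<Rightarrow> complex) \<Rightarrow> 'a::cstar_algebra) \<Rightarrow> bool" where
  "reduced_cstar_algebra G \<iota> \<longleftrightarrow>
     (\<forall>f\<in>Cc. \<forall>g\<in>Cc. \<iota> (\<lambda>x. f x + g x) = \<iota> f + \<iota> g)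
     \<and> (\<forall>c. \<forall>f\<in>Cc. \<iota> (\<lambda>x. c * f x) = c *\<^sub>C \<iota> f)
     \<and> (\<forall>f\<in>Cc. \<forall>g\<in>Cc. \<iota> (convolution G f g) = \<iota> f * \<iota> g)
     \<and> (\<forall>f\<in>Cc. \<iota> (involution G f) = star (\<iota> f))
     \<and> (\<forall>f\<in>Cc. norm (\<iota> f) = reduced_norm G f)
     \<and> closure (\<iota> ` Cc) = UNIV"


section \<open>Functions on the unit space\<close>

text \<open>Only the values on \<open>X\<close> matter in the following definitions.\<close>

definition C0 :: "'g::topological_space set \<Rightarrow> ('g \<Rightarrow> complex) set" where
  "C0 X = {p. continuous_on X p \<and> (\<forall>\<epsilon>>0. compact {x \<in> X. \<epsilon> \<le> cmod (p x)})}"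

definition function_projection :: "'g set \<Rightarrow> ('g \<Rightarrow> complex) \<Rightarrow> bool" where
  "function_projection X p \<longleftrightarrow> (\<forall>x\<in>X. cnj (p x) = p x \<and> p x * p x = p x)"

definition function_support :: "'g::topological_space set \<Rightarrow> ('g \<Rightarrow> complex) \<Rightarrow> 'g set" where
  "function_support X p = (top_of_set X) closure_of {x \<in> X. p x \<noteq> 0}"

text \<open>
  A function in \<open>C0 (units G)\<close> with compact support extends by zero to an element of \<^term>\<open>Cc\<close>
  when \<open>G\<close> is ample and Hausdorff, since \<open>units G\<close> is then clopen. Its image under \<open>\<iota>\<close> is
  therefore its image under the embedding of \<open>C0 (units G)\<close> in the reduced C*-algebra.
\<close>

definition extend_by_zero :: "'g set \<Rightarrow> ('g \<Rightarrow> complex) \<Rightarrow> 'g \<Rightarrow> complex" where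
  "extend_by_zero X p = (\<lambda>x. if x \<in> X then p x else 0)"

end

theory Submission
  imports Defs
begin

text \<open>
  Write \<open>P\<^sub>V\<close> for the indicator function of a compact open set \<open>V\<close> of units.

  Compression: if \<open>x \<noteq> 0\<close>, then \<open>P\<^sub>V = v\<^sup>* x\<^sup>* x v\<close> for some nonempty \<open>V\<close> and some \<open>v\<close>. Approximate
  \<open>x\<^sup>* x\<close> by \<open>g\<close> in \<open>C\<^sub>c(G)\<close> with a value bounded away from \<open>0\<close> at a unit; near a unit with trivial
  isotropy one finds \<open>V\<close> such that \<open>P\<^sub>V g P\<^sub>V\<close> lives on the units and is nearly constant on \<open>V\<close>, so
  \<open>P\<^sub>V x\<^sup>* x P\<^sub>V\<close> is close to a positive multiple of \<open>P\<^sub>V\<close> and has an inverse square root in the corner.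

  Covering: by minimality every compact open set of units is a finite disjoint union of ranges of
  bisections with source in a given \<open>V\<close>, so each \<open>P\<^sub>W\<close> is a finite sum of terms \<open>y P\<^sub>V y\<^sup>*\<close>.

  Absorption: an infinite projection \<open>p\<close> has room for infinitely many orthogonal copies of
  \<open>e = p - tt\<^sup>* \<noteq> 0\<close>, hence by compression of some \<open>P\<^sub>V\<close>, hence by covering \<open>P\<^sub>W \<precsim> p\<close> for all \<open>W\<close>. As the
  \<open>P\<^sub>W\<close> form an approximate unit, everything is below \<open>p\<close>, and \<open>p\<close> is below any \<open>b \<noteq> 0\<close> if its support
  was chosen inside the set obtained by compressing \<open>b\<close>.

  Conversely, in a purely infinite algebra covering gives an isometry from \<open>P\<^sub>U\<close> into \<open>P\<^sub>V\<close> for any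
  \<open>V \<subset> U\<close>. If \<open>U = {u}\<close> there is no such \<open>V\<close>, but then the corner of \<open>P\<^sub>U\<close> is one-dimensional, so that
  either \<open>G = {u}\<close> and the algebra has a character, or some \<open>P\<^sub>W\<close> strictly above \<open>P\<^sub>U\<close> would embed into it.
\<close>

section \<open>C*-algebras\<close>

lemma scaleC_0_left [simp]: "0 *\<^sub>C x = (0::'a::cstar_algebra)"
  using scaleC_of_real[of 0 x] by simp

lemma scaleC_1_left [simp]: "1 *\<^sub>C x = (x::'a::cstar_algebra)"
  using scaleC_of_real[of 1 x] by simp

lemma scaleC_minus1: "(-1) *\<^sub>C x = - (x::'a::cstar_algebra)"
  using scaleC_of_real[of "-1" x] by simp

lemma star_scaleR: "star (t *\<^sub>R x) = t *\<^sub>R star (x::'a::cstar_algebra)"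
  by (simp flip: scaleC_of_real add: star_scaleC)

lemma star_0 [simp]: "star 0 = (0::'a::cstar_algebra)"
  using star_scaleR[of 0 "0::'a"] by simp

lemma star_minus: "star (- x) = - star (x::'a::cstar_algebra)"
  using star_scaleR[of "-1" x] by simp

lemma star_diff: "star (x - y) = star x - star (y::'a::cstar_algebra)"
  using star_add[of x "-y"] by (simp add: star_minus)

text \<open>The C*-identity and submultiplicativity bound the square of \<open>norm x\<close> by
  \<open>norm (star x) * norm x\<close>; cancelling gives one inequality, and its instance at
  \<open>star x\<close> the other.\<close>

lemma norm_star [simp]: "norm (star x) = norm (x::'a::cstar_algebra)"
proof -
  have *: "norm x \<le> norm (star x)" for x :: 'a
  proof (cases "x = 0")
    case False
    have "norm x * norm x \<le> norm (star x) * norm x"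
      using norm_mult_ineq[of "star x" x] by (simp add: cstar_identity power2_eq_square)
    with False show ?thesis by simp
  qed simp
  show ?thesis using *[of x] *[of "star x"] by (simp add: star_star)
qed

lemma bounded_linear_star: "bounded_linear (star :: 'a::cstar_algebra \<Rightarrow> 'a)"
  by (rule bounded_linear_intro[where K=1]) (auto simp: star_add star_scaleR)

lemma star_mult_self_eq_0_iff [simp]: "star x * x = 0 \<longleftrightarrow> x = (0::'a::cstar_algebra)"
  using cstar_identity[of x] by auto

section \<open>Projections, and square roots of elements close to them\<close>

lemma is_projectionD:
  assumes "is_projection p" shows "star p = p" "p * p = p" "p * (p * x) = p * x"
  using assms by (auto simp: is_projection_def simp flip: mult.assoc)

lemma norm_projection_le_1:
  fixes p :: "'a::cstar_algebra"
  assumes "is_projection p" shows "norm p \<le> 1"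
  using cstar_identity[of p] is_projectionD[OF assms]
  by (metis dual_order.refl mult_cancel_right2 power2_eq_square zero_le_one)

text \<open>With \<open>d = p - y\<close>, a fixed point \<open>r\<close> of \<open>r \<mapsto> (d + r\<^sup>2)/2\<close> gives the square root \<open>p - r\<close> of \<open>y\<close>,
  and a fixed point of \<open>v \<mapsto> p + r v\<close> inverts it in the corner of \<open>p\<close>.\<close>

lemma inverse_sqrt_near_projection:
  fixes p y :: "'a::cstar_algebra"
  assumes p: "is_projection p" and y: "star y = y" "p * y = y" "y * p = y"
    and near: "norm (y - p) \<le> 3/4"
  obtains v where "star v = v" "v * p = v" "v * y * v = p"
proof -
  note pp = is_projectionD[OF p]
  define d where "d = p - y"
  have d: "star d = d" "p * d = d" "d * p = d" "norm d \<le> 3/4"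
    using y pp near by (auto simp: d_def star_diff algebra_simps norm_minus_commute)
  \<comment> \<open>The radius 1/2 fits the bound 3/4 on \<open>d\<close>: the ball is preserved
    because (3/4 + 1/4)/2 = 1/2, and on it squaring followed by halving has Lipschitz constant
    1/2.\<close>
  define S where "S = {r :: 'a. norm r \<le> 1/2 \<and> star r = r \<and> p * r = r \<and> r * p = r}"
  have "closed S" unfolding S_def
    by (intro closed_Collect_conj closed_Collect_le closed_Collect_eq continuous_intros
        bounded_linear.continuous_on[OF bounded_linear_star])
  have "\<exists>!r. r \<in> S \<and> (1/2) *\<^sub>R (d + r * r) = r"
  proof (rule Banach_fix)
    show "complete S" using \<open>closed S\<close> by (simp add: complete_eq_closed)
    show "S \<noteq> {}" by (auto simp: S_def intro!: exI[of _ 0])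
    show "(0::real) \<le> 1/2" "(1/2::real) < 1" by auto
    show "(\<lambda>r. (1/2) *\<^sub>R (d + r * r)) ` S \<subseteq> S"
    proof safe
      fix r assume r: "r \<in> S"
      have "norm (r * r) \<le> (1/2) * (1/2)"
        using r by (intro norm_mult_ineq[THEN order_trans] mult_mono) (auto simp: S_def)
      then have "norm (d + r * r) \<le> 1" using d(4) norm_triangle_ineq[of d "r*r"] by linarith
      then have 1: "norm ((1/2) *\<^sub>R (d + r * r)) \<le> 1/2" by simp
      have 2: "p * (r * r) = r * r" "r * r * p = r * r" "star (r * r) = r * r"
        using r by (auto simp: S_def star_mult simp flip: mult.assoc) (simp add: mult.assoc)
      show "(1/2) *\<^sub>R (d + r * r) \<in> S" using 1 2 d
        unfolding S_def by (simp add: star_scaleR star_add distrib_left distrib_right)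
    qed
    show "dist ((1/2) *\<^sub>R (d + x * x)) ((1/2) *\<^sub>R (d + y * y)) \<le> 1/2 * dist x y"
      if xy: "x \<in> S" "y \<in> S" for x y
    proof -
      have "norm (x * x - y * y) = norm (x * (x - y) + (x - y) * y)"
        by (simp add: algebra_simps)
      also have "\<dots> \<le> norm x * norm (x - y) + norm (x - y) * norm y"
        by (intro norm_triangle_le add_mono norm_mult_ineq)
      also have "\<dots> \<le> (1/2) * norm (x - y) + norm (x - y) * (1/2)"
        using xy by (intro add_mono mult_mono) (auto simp: S_def)
      finally have "norm (x * x - y * y) \<le> norm (x - y)" by simp
      then show ?thesis
        by (simp add: dist_norm flip: scaleR_diff_right)
    qed
  qed
  then obtain r where r: "r \<in> S" "(1/2) *\<^sub>R (d + r * r) = r" by blast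
  have "2 *\<^sub>R ((1/2) *\<^sub>R (d + r * r)) = 2 *\<^sub>R r" using r(2) by simp
  then have dr: "d + r * r = r + r" by (simp add: scaleR_2)
  define c where "c = p - r"
  have c: "star c = c" "c * p = c" "p * c = c" using r pp by (auto simp: c_def S_def star_diff algebra_simps)
  have cc: "c * c = y" using dr r pp unfolding c_def d_def S_def by (auto simp: algebra_simps)
  \<comment> \<open>The fixed point sought is the Neumann series \<open>p + r + r * r + ...\<close>,
    with \<open>p\<close> acting as the unit of its corner.\<close>
  define T where "T = {v :: 'a. v * p = v}"
  have "closed T" unfolding T_def by (intro closed_Collect_eq continuous_intros)
  have "\<exists>!v. v \<in> T \<and> p + r * v = v"
  proof (rule Banach_fix)
    show "complete T" using \<open>closed T\<close> by (simp add: complete_eq_closed)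
    show "T \<noteq> {}" by (auto simp: T_def intro!: exI[of _ 0])
    show "(0::real) \<le> 1/2" "(1/2::real) < 1" by auto
    show "(\<lambda>v. p + r * v) ` T \<subseteq> T" using pp by (auto simp: T_def algebra_simps)
    show "dist (p + r * x) (p + r * y) \<le> 1/2 * dist x y" for x y
    proof -
      have "norm (r * (x - y)) \<le> 1/2 * norm (x - y)"
        using r by (intro norm_mult_ineq[THEN order_trans] mult_right_mono) (auto simp: S_def)
      then show ?thesis
        by (simp add: dist_norm algebra_simps)
    qed
  qed
  then obtain v where v: "v * p = v" "p + r * v = v" by (auto simp: T_def)
  have rv: "p * (r * v) = r * v" using r by (simp add: S_def flip: mult.assoc)
  have pv: "p * v = v"
    using v(2) rv pp(2) by (metis distrib_left)
  have cv: "c * v = p" using v(2) pv by (simp add: c_def left_diff_distrib) (metis add_diff_cancel_right')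
  \<comment> \<open>The right inverse \<open>v\<close> of the self-adjoint \<open>c\<close> yields
    the left inverse \<open>star v\<close>, and the two must agree:
    \<open>star v = star v * c * v = v\<close>.\<close>
  have "star v * c = p" using arg_cong[OF cv, of star] by (simp add: star_mult c pp)
  then have "star v * c * v = v" using pv by simp
  moreover have "star v * p = star v" using arg_cong[OF pv, of star] by (simp add: star_mult pp)
  ultimately have sv: "star v = v" using cv by (simp add: mult.assoc)
  have "v * c = p" using \<open>star v * c = p\<close> sv by simp
  then have "v * y * v = p" using cv by (simp flip: cc add: mult.assoc) (simp add: pp flip: mult.assoc)
  then show ?thesis using sv v(1) that by blast
qed

text \<open>Dividing by \<delta> puts the compression of \<open>b\<close> within 3/4 of
  \<open>p\<close>, where an inverse square root exists in the corner. The factor \<delta> is then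
  absorbed by rescaling with \<open>1 / sqrt \<delta>\<close>.\<close>

lemma projection_compression:
  fixes p b :: "'a::cstar_algebra"
  assumes p: "is_projection p" and b: "star b = b" and \<delta>: "\<delta> > 0"
    and near: "norm (p * b * p - \<delta> *\<^sub>R p) \<le> 3/4 * \<delta>"
  obtains v where "star v * b * v = p"
proof -
  note pp = is_projectionD[OF p]
  define y where "y = (1/\<delta>) *\<^sub>R (p * b * p)"
  have "y - p = (1/\<delta>) *\<^sub>R (p * b * p - \<delta> *\<^sub>R p)" using \<delta> by (simp add: y_def scaleR_diff_right)
  then have "norm (y - p) \<le> 3/4" using near \<delta> by (simp add: pos_divide_le_eq)
  moreover have "star y = y" "p * y = y" "y * p = y"
    using pp b by (simp_all add: y_def star_scaleR star_mult mult.assoc)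
  ultimately obtain v where v: "star v = v" "v * p = v" "v * y * v = p"
    using inverse_sqrt_near_projection[OF p] by metis
  have pv: "p * v = v" using v(1,2) pp(1) by (metis star_mult)
  have "(1/\<delta>) *\<^sub>R ((v * p) * b * (p * v)) = p" using v(3) by (simp add: y_def mult.assoc)
  then have "(1/\<delta>) *\<^sub>R (v * b * v) = p" using pv v by simp
  moreover have "(1 / sqrt \<delta>) * (1 / sqrt \<delta>) = 1 / \<delta>" using \<delta> by simp
  ultimately have "star ((1/sqrt \<delta>) *\<^sub>R v) * b * ((1/sqrt \<delta>) *\<^sub>R v) = p"
    using v(1) \<delta> by (simp add: star_scaleR)
  then show ?thesis by (rule that)
qed

section \<open>Cuntz comparison\<close>

lemma cuntz_below_iff:
  "a \<precsim> b \<longleftrightarrow> (\<forall>\<epsilon>>0. \<exists>x. norm (star x * b * x - a) < \<epsilon>)"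
proof
  assume "a \<precsim> b"
  then show "\<forall>\<epsilon>>0. \<exists>x. norm (star x * b * x - a) < \<epsilon>"
    by (fastforce simp: cuntz_below_def LIMSEQ_iff)
next
  assume "\<forall>\<epsilon>>0. \<exists>x. norm (star x * b * x - a) < \<epsilon>"
  then have "\<exists>x. norm (star x * b * x - a) < inverse (real (Suc n))" for n by simp
  then obtain x where x: "\<And>n. norm (star (x n) * b * x n - a) < inverse (real (Suc n))" by metis
  have "(\<lambda>n. star (x n) * b * x n - a) \<longlonglongrightarrow> 0"
    by (rule Lim_null_comparison[OF _ LIMSEQ_inverse_real_of_nat]) (intro always_eventually allI less_imp_le x)
  then show "a \<precsim> b" by (auto simp: cuntz_below_def LIM_zero_iff)
qed

lemma cuntz_below_compression: "star x * b * x \<precsim> b"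
  unfolding cuntz_below_def by (rule exI[of _ "\<lambda>_. x"]) (rule tendsto_const)

lemma cuntz_below_closure:
  fixes a b :: "'a::cstar_algebra"
  assumes "\<And>\<epsilon>. \<epsilon> > 0 \<Longrightarrow> \<exists>c. norm (c - a) < \<epsilon> \<and> c \<precsim> b"
  shows "a \<precsim> b"
  unfolding cuntz_below_iff
proof (intro allI impI)
  fix \<epsilon> :: real assume "\<epsilon> > 0"
  then obtain c where c: "norm (c - a) < \<epsilon>/2" "c \<precsim> b" using assms[of "\<epsilon>/2"] by auto
  then obtain x where "norm (star x * b * x - c) < \<epsilon>/2"
    using \<open>\<epsilon> > 0\<close> unfolding cuntz_below_iff by (meson half_gt_zero)
  then have "norm (star x * b * x - a) < \<epsilon>"
    using c(1) norm_triangle_ineq[of "star x * b * x - c" "c - a"] by simp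
  then show "\<exists>x. norm (star x * b * x - a) < \<epsilon>" ..
qed

text \<open>Each approximant \<open>star (x k) * b * x k\<close> of \<open>a\<close> is itself below
  \<open>c\<close>, with \<open>y k * u\<close> as the compressing elements. Closedness of the
  relation in its left argument replaces a diagonal choice of indices.\<close>

lemma cuntz_below_trans:
  fixes a b c :: "'a::cstar_algebra"
  assumes "a \<precsim> b" "b \<precsim> c" shows "a \<precsim> c"
proof -
  obtain x where x: "(\<lambda>k. star (x k) * b * x k) \<longlonglongrightarrow> a" using assms by (auto simp: cuntz_below_def)
  obtain y where y: "(\<lambda>k. star (y k) * c * y k) \<longlonglongrightarrow> b" using assms by (auto simp: cuntz_below_def)
  have *: "star u * b * u \<precsim> c" for u
  proof -
    have "(\<lambda>k. star u * (star (y k) * c * y k) * u) \<longlonglongrightarrow> star u * b * u"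
      by (intro tendsto_intros y)
    then show ?thesis unfolding cuntz_below_def
      by (intro exI[of _ "\<lambda>k. y k * u"]) (simp add: star_mult mult.assoc)
  qed
  show ?thesis
  proof (rule cuntz_below_closure)
    fix \<epsilon> :: real assume "\<epsilon> > 0"
    then obtain k where "norm (star (x k) * b * x k - a) < \<epsilon>" using x by (fastforce simp: LIMSEQ_iff)
    then show "\<exists>d. norm (d - a) < \<epsilon> \<and> d \<precsim> c" using * by blast
  qed
qed

text \<open>An approximate compression of \<open>q\<close> to \<open>p\<close> with error below 3/4
  can be corrected to an exact one. Between projections, Cuntz comparison is therefore Murray-von
  Neumann comparison.\<close>

lemma projection_below_projection:
  fixes p q :: "'a::cstar_algebra"
  assumes "is_projection p" "is_projection q" "p \<precsim> q"
  obtains t where "star t * t = p" "q * t = t"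
proof -
  note pp = is_projectionD[OF assms(1)] and qq = is_projectionD[OF assms(2)]
  obtain x where x: "norm (star x * q * x - p) < 3/4"
    using assms(3) unfolding cuntz_below_iff by (meson zero_less_divide_iff zero_less_numeral)
  have "norm (p * (star x * q * x - p) * p) \<le> 1 * norm (star x * q * x - p) * 1"
    using norm_projection_le_1[OF assms(1)]
    by (intro norm_mult_ineq[THEN order_trans] mult_mono) auto
  moreover have "p * (star x * q * x - p) * p = p * (star x * q * x) * p - p"
    by (simp add: right_diff_distrib left_diff_distrib pp)
  ultimately have "norm (p * (star x * q * x) * p - 1 *\<^sub>R p) \<le> 3/4 * 1" using x by simp
  then obtain v where "star v * (star x * q * x) * v = p"
    using projection_compression[OF assms(1), of "star x * q * x" 1]
    by (metis mult.assoc qq(1) star_mult star_star zero_less_one)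
  then have "star (q * x * v) * (q * x * v) = p"
    by (simp add: star_mult qq mult.assoc)
  moreover have "q * (q * x * v) = q * x * v" by (simp add: qq mult.assoc)
  ultimately show ?thesis by (rule that)
qed

section \<open>Ideals, characters and infinite projections\<close>

lemma closed_two_sided_ideal_generated: "closed_two_sided_ideal (closed_ideal_generated b)"
proof -
  let ?\<I> = "{I. closed_two_sided_ideal I \<and> b \<in> I}"
  have "closed (\<Inter>?\<I>)" by (intro closed_Inter) (simp add: closed_two_sided_ideal_def)
  then show ?thesis
    unfolding closed_ideal_generated_def closed_two_sided_ideal_def[of "\<Inter>?\<I>"]
    by (simp add: closed_two_sided_ideal_def)
qed

text \<open>This is the half of the equivalence in the definition of pure infiniteness that holds in
  every C*-algebra.\<close>

lemma cuntz_below_imp_in_ideal: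
  assumes "a \<precsim> b" shows "a \<in> closed_ideal_generated b"
proof -
  note I = closed_two_sided_ideal_generated[of b, unfolded closed_two_sided_ideal_def]
  obtain x where x: "(\<lambda>k. star (x k) * b * x k) \<longlonglongrightarrow> a" using assms by (auto simp: cuntz_below_def)
  have "b \<in> closed_ideal_generated b" by (auto simp: closed_ideal_generated_def)
  then have "star (x k) * b * x k \<in> closed_ideal_generated b" for k using I by blast
  moreover have "closed (closed_ideal_generated b)" using I by blast
  ultimately show ?thesis using closed_sequentially[OF _ _ x] by blast
qed

text \<open>If \<open>\<phi> x = 1\<close> and \<open>\<parallel>x\<parallel> < 1\<close>, then a fixed point of \<open>y \<mapsto> x + x y\<close> is absurd.\<close>

lemma character_contractive:
  fixes \<phi> :: "'a::cstar_algebra \<Rightarrow> complex"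
  assumes "algebra_character \<phi>" shows "cmod (\<phi> x) \<le> norm x"
proof (rule ccontr)
  note \<phi> = assms[unfolded algebra_character_def]
  assume "\<not> ?thesis"
  then have *: "norm x < cmod (\<phi> x)" by simp
  then have "\<phi> x \<noteq> 0" using norm_ge_zero[of x] by (metis norm_zero not_less)
  define z where "z = (1 / \<phi> x) *\<^sub>C x"
  have z: "\<phi> z = 1" "norm z < 1"
    using \<phi> * \<open>\<phi> x \<noteq> 0\<close> by (auto simp: z_def norm_scaleC norm_divide)
  have "\<exists>!y. z + z * y = y"
  proof (rule banach_fix_type)
    show "\<forall>x y. dist (z + z * x) (z + z * y) \<le> norm z * dist x y"
      using norm_mult_ineq[of z] by (simp add: dist_norm flip: right_diff_distrib)
  qed (use z in auto)
  then obtain y where "z + z * y = y" by auto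
  then have "\<phi> y = \<phi> z + \<phi> z * \<phi> y" using \<phi> by metis
  then show False using z by simp
qed

text \<open>Contractivity makes a character continuous, so vanishing on a dense set would make it
  zero. The dense set in view is the image of \<open>Cc\<close>.\<close>

lemma character_nonzero_on_dense:
  fixes \<phi> :: "'a::cstar_algebra \<Rightarrow> complex"
  assumes \<phi>: "algebra_character \<phi>" and D: "closure D = UNIV"
  obtains d where "d \<in> D" "\<phi> d \<noteq> 0"
proof -
  obtain x where x: "\<phi> x \<noteq> 0" using \<phi> by (auto simp: algebra_character_def)
  then obtain d where d: "d \<in> D" "dist d x < cmod (\<phi> x)"
    using D by (metis UNIV_I closure_approachable zero_less_norm_iff)
  have "\<phi> (d - x) = \<phi> d - \<phi> x"
    using \<phi> unfolding algebra_character_def by (metis add_diff_cancel_right' diff_add_cancel)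
  then have "\<phi> d \<noteq> 0" using character_contractive[OF \<phi>, of "d - x"] d(2) by (auto simp: dist_norm)
  with d(1) show ?thesis by (rule that)
qed

text \<open>The element \<open>r\<close> detects that the range projection of \<open>t\<close> is
  proper: it annihilates \<open>t\<close> but not \<open>p\<close>.\<close>

lemma infinite_projectionI:
  fixes p r t :: "'a::cstar_algebra"
  assumes "is_projection p" "star t * t = p" "p * t = t" "r * t = 0" "r * p \<noteq> 0"
  shows "infinite_projection p"
proof -
  note pp = is_projectionD[OF assms(1)]
  have sp: "star t * p = star t" using arg_cong[OF assms(3), of star] by (simp add: star_mult pp)
  \<comment> \<open>With \<open>star t * t = p\<close> the four terms cancel, so the C*-identity
    forces \<open>t = t * p\<close>.\<close>
  have "star (t - t * p) * (t - t * p) = star t * t - star t * t * p - p * (star t * t) + p * (star t * t) * p"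
    by (simp add: star_diff star_mult pp algebra_simps)
  then have "t * p = t" by (simp add: assms(2) pp)
  then have pi: "t * star t * t = t" by (simp add: mult.assoc assms(2))
  \<comment> \<open>The difference is shown to be a projection, hence equal to its own square and
    positive.\<close>
  have "star (p - t * star t) * (p - t * star t)
      = p * p - (p * t) * star t - t * (star t * p) + (t * star t * t) * star t"
    by (simp add: star_diff star_mult star_star pp(1) algebra_simps)
  then have "star (p - t * star t) * (p - t * star t) = p - t * star t"
    by (simp add: pp assms(3) sp pi)
  then have "p - t * star t \<in> positive_cone" unfolding positive_cone_def by (metis (mono_tags, lifting) mem_Collect_eq)
  moreover have "t * star t \<noteq> p" using assms(4,5) by (metis mult.assoc mult_zero_left)
  ultimately show ?thesis
    unfolding infinite_projection_def partial_isometry_def using assms pi by blast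
qed

text \<open>Projections are positive, so pure infiniteness converts ideal membership into Cuntz
  comparison, which for projections gives an isometry.\<close>

lemma purely_infinite_below:
  fixes p q :: "'a::cstar_algebra"
  assumes "purely_infinite TYPE('a)" "is_projection p" "is_projection q" "p \<in> closed_ideal_generated q"
  obtains t where "star t * t = p" "q * t = t"
proof -
  have "r \<in> positive_cone" if "is_projection r" for r :: 'a
    using is_projectionD(1,2)[OF that] unfolding positive_cone_def by (metis (mono_tags, lifting) mem_Collect_eq)
  then have "p \<precsim> q" using assms unfolding purely_infinite_def by blast
  then show ?thesis using projection_below_projection[OF assms(2,3)] that by blast
qed

section \<open>Ample groupoids and convolution\<close>

context groupoid
begin

lemma rng_eq_self [simp]: "u \<in> units G \<Longrightarrow> rng G u = u"
  and src_eq_self [simp]: "u \<in> units G \<Longrightarrow> src G u = u"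
  by (auto simp: units_def)

lemma rng_src_idem [simp]:
  "rng G (rng G x) = rng G x" "src G (rng G x) = rng G x"
  "rng G (src G x) = src G x" "src G (src G x) = src G x"
  using rng_unit src_unit by auto

lemma units_iff_src: "x \<in> units G \<longleftrightarrow> src G x = x"
  using src_unit[of x] by auto

lemma mult_ginv_mult: "rng G y = rng G x \<Longrightarrow> mult G y (mult G (ginv G y) x) = x"
  by (metis ginv_right mult_assoc rng_ginv rng_mult_left src_ginv)

lemma mult_mult_ginv: "src G y = rng G x \<Longrightarrow> mult G (mult G y x) (ginv G x) = y"
  by (metis ginv_right mult_assoc mult_src_right rng_ginv)

lemma ginv_mult_mult: "src G y = rng G x \<Longrightarrow> mult G (ginv G y) (mult G y x) = x"
  by (metis ginv_left mult_assoc rng_mult_left src_ginv)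

lemma mult_ginv_cancel: "src G z = src G x \<Longrightarrow> mult G (mult G z (ginv G x)) x = z"
  by (metis ginv_left mult_assoc mult_src_right rng_ginv src_ginv)

lemma ginv_ginv [simp]: "ginv G (ginv G x) = x"
  by (metis ginv_left ginv_mult_mult mult_src_right rng_ginv src_ginv)

lemma ginv_of_unit [simp]: "u \<in> units G \<Longrightarrow> ginv G u = u"
  by (metis ginv_left mult_src_right rng_eq_self src_eq_self src_ginv)

lemma ginv_mult:
  assumes "src G x = rng G y"
  shows "ginv G (mult G x y) = mult G (ginv G y) (ginv G x)"
proof -
  have "mult G (ginv G (mult G x y)) (mult G (mult G x y) (mult G (ginv G y) (ginv G x)))
      = mult G (ginv G y) (ginv G x)"
    by (rule ginv_mult_mult) (simp add: assms src_mult rng_mult rng_ginv src_ginv)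
  moreover have "mult G (mult G x y) (mult G (ginv G y) (ginv G x)) = rng G x"
    using assms by (metis ginv_right mult_assoc mult_mult_ginv rng_ginv rng_mult src_ginv src_mult)
  ultimately show ?thesis using assms
    by (metis mult_src_right rng_mult src_ginv)
qed

end

section \<open>Topology of a Hausdorff ample groupoid\<close>

locale hausdorff_ample_groupoid = ample_groupoid G
  for G :: "'g::t2_space groupoid_data"
begin

lemma continuous_on_ginv: "continuous_on A (ginv G)"
  using ginv_homeomorphism unfolding homeomorphism_def by (metis continuous_on_subset subset_UNIV)

lemma continuous_on_mult:
  assumes "continuous_on A f" "continuous_on A g" "\<And>x. x \<in> A \<Longrightarrow> src G (f x) = rng G (g x)"
  shows "continuous_on A (\<lambda>x. mult G (f x) (g x))"
proof -
  have "continuous_on A (\<lambda>x. (f x, g x))" using assms by (intro continuous_intros)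
  from continuous_on_compose2[OF mult_continuous this] assms(3) show ?thesis by auto
qed

text \<open>The source of \<open>x\<close> is the product of \<open>ginv G x\<close> and
  \<open>x\<close>, so continuity comes from multiplication and inversion.\<close>

lemma continuous_on_src: "continuous_on A (src G)"
proof -
  have "continuous_on A (\<lambda>x. mult G (ginv G x) x)"
    by (intro continuous_on_mult continuous_on_ginv continuous_on_id) (simp add: src_ginv)
  then show ?thesis by (simp add: ginv_left)
qed

lemma continuous_on_rng: "continuous_on A (rng G)"
proof -
  have "continuous_on A (\<lambda>x. mult G x (ginv G x))"
    by (intro continuous_on_mult continuous_on_ginv continuous_on_id) (simp add: rng_ginv)
  then show ?thesis by (simp add: ginv_right)
qed

lemma open_vimage_src: "open V \<Longrightarrow> open (src G -` V)"
  and open_vimage_rng: "open V \<Longrightarrow> open (rng G -` V)"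
  by (intro open_vimage continuous_on_src continuous_on_rng; assumption)+

lemma closed_vimage_rng: "closed V \<Longrightarrow> closed (rng G -` V)"
  by (intro closed_vimage continuous_on_rng)

text \<open>Injectivity stands in for the homeomorphism conditions: on a compact set a continuous
  injection into a Hausdorff space is a homeomorphism onto its image. In this form the notion passes
  at once to clopen pieces.\<close>

definition bisection :: "'g set \<Rightarrow> bool" where
  "bisection B \<longleftrightarrow> compact B \<and> open B \<and> inj_on (rng G) B \<and> inj_on (src G) B"

lemma bisection_subset:
  assumes "bisection B" "closed C" "open C"
  shows "bisection (B \<inter> C)"
  using assms unfolding bisection_def by (meson compact_Int_closed inf_le1 inj_on_subset open_Int)

lemma ample_basis:
  assumes "open W" "x \<in> W"
  obtains B where "bisection B" "open_bisection G B" "x \<in> B" "B \<subseteq> W"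
proof -
  obtain \<B> where B: "topological_basis \<B>" "\<And>B. B \<in> \<B> \<Longrightarrow> compact B \<and> open_bisection G B"
    using ample by auto
  obtain B where "B \<in> \<B>" "x \<in> B" "B \<subseteq> W"
    using topological_basisE[OF B(1) assms] by blast
  moreover have "bisection B"
    using B(2)[OF \<open>B \<in> \<B>\<close>] unfolding bisection_def open_bisection_def homeomorphism_def
    by (metis inj_on_inverseI)
  ultimately show ?thesis using B(2) that by blast
qed

text \<open>If both \<open>x\<close> and \<open>src G x\<close> lie in a bisection, they have the
  same source and so coincide. Near a unit, every element whose source is also near that unit is
  therefore a unit.\<close>

lemma open_units: "open (units G)"
proof (rule Topological_Spaces.openI)
  fix u assume u: "u \<in> units G"
  obtain B where B: "bisection B" "u \<in> B" by (rule ample_basis[OF open_UNIV UNIV_I])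
  have "B \<inter> src G -` B \<subseteq> units G"
  proof
    fix x assume x: "x \<in> B \<inter> src G -` B"
    then have "x = src G x"
      using B(1) by (auto simp: bisection_def inj_on_def)
    then show "x \<in> units G" by (simp add: units_iff_src)
  qed
  moreover have "open (B \<inter> src G -` B)" using B by (auto simp: bisection_def intro: open_vimage_src)
  moreover have "u \<in> B \<inter> src G -` B" using u B by simp
  ultimately show "\<exists>T. open T \<and> u \<in> T \<and> T \<subseteq> units G" by blast
qed

lemma openin_units_iff: "openin (top_of_set (units G)) V \<longleftrightarrow> open V \<and> V \<subseteq> units G"
  by (simp add: openin_open_eq open_units)

text \<open>Basic open bisections have ranges open in the unit space, which is itself open in
  \<open>G\<close>.\<close>

lemma open_rng_image:
  assumes "open W" shows "open (rng G ` W)"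
proof (rule Topological_Spaces.openI)
  fix u assume "u \<in> rng G ` W"
  then obtain x where x: "x \<in> W" "u = rng G x" by blast
  obtain B where B: "open_bisection G B" "x \<in> B" "B \<subseteq> W" using ample_basis[OF assms x(1)] by metis
  moreover from B(1) have "open (rng G ` B)" by (simp only: open_bisection_def openin_units_iff)
  ultimately show "\<exists>T. open T \<and> u \<in> T \<and> T \<subseteq> rng G ` W" using x by blast
qed

definition compact_open_units :: "'g set \<Rightarrow> bool" where
  "compact_open_units V \<longleftrightarrow> compact V \<and> open V \<and> V \<subseteq> units G"

lemma compact_open_unitsD:
  assumes "compact_open_units V"
  shows "compact V" "open V" "closed V" "V \<subseteq> units G"
  using assms by (auto simp: compact_open_units_def compact_imp_closed)

lemma compact_open_units_Int: "compact_open_units V \<Longrightarrow> compact_open_units W \<Longrightarrow> compact_open_units (V \<inter> W)"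
  and compact_open_units_Un: "compact_open_units V \<Longrightarrow> compact_open_units W \<Longrightarrow> compact_open_units (V \<union> W)"
  and compact_open_units_Diff: "compact_open_units V \<Longrightarrow> compact_open_units W \<Longrightarrow> compact_open_units (V - W)"
  by (auto simp: compact_open_units_def compact_Int compact_Un compact_diff compact_imp_closed open_Diff)

lemma compact_open_units_empty [simp]: "compact_open_units {}"
  by (simp add: compact_open_units_def)

lemma compact_open_units_rng: "bisection B \<Longrightarrow> compact_open_units (rng G ` B)"
  unfolding bisection_def compact_open_units_def
  by (auto simp: compact_continuous_image continuous_on_rng open_rng_image rng_unit)

lemma compact_open_units_nbhd:
  assumes "open W" "u \<in> W" "u \<in> units G"
  obtains V where "compact_open_units V" "u \<in> V" "V \<subseteq> W"
proof -
  have "open (W \<inter> units G)" using assms open_units by auto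
  then obtain B where "bisection B" "u \<in> B" "B \<subseteq> W \<inter> units G"
    using ample_basis[of "W \<inter> units G" u] assms by (metis IntI)
  then show ?thesis by (intro that[of B]) (auto simp: compact_open_units_def bisection_def)
qed

lemma compact_open_units_cover:
  assumes "compact K"
  obtains V where "compact_open_units V" "rng G ` K \<subseteq> V"
proof -
  have K: "compact (rng G ` K)" using assms by (intro compact_continuous_image continuous_on_rng)
  have "rng G ` K \<subseteq> \<Union>{V. compact_open_units V}"
  proof
    fix u assume "u \<in> rng G ` K"
    then have "u \<in> units G" using rng_unit by blast
    then obtain V where "compact_open_units V" "u \<in> V"
      by (rule compact_open_units_nbhd[OF open_UNIV UNIV_I])
    then show "u \<in> \<Union>{V. compact_open_units V}" by blast
  qed
  from compactE[OF K this] obtain \<F> where \<F>: "\<F> \<subseteq> {V. compact_open_units V}" "finite \<F>" "rng G ` K \<subseteq> \<Union>\<F>"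
    by (metis compact_open_unitsD(2) mem_Collect_eq)
  have "compact_open_units (\<Union>\<F>)"
    using \<F>(2,1) by (induction \<F> rule: finite_induct) (auto simp: compact_open_units_Un)
  then show ?thesis using \<F>(3) by (rule that)
qed

lemma bisection_cover:
  assumes "compact K"
  obtains \<F> where "finite \<F>" "\<And>B. B \<in> \<F> \<Longrightarrow> bisection B" "K \<subseteq> \<Union>\<F>"
proof -
  have "K \<subseteq> \<Union>{B. bisection B}"
  proof
    fix x
    obtain B where "bisection B" "x \<in> B" by (rule ample_basis[OF open_UNIV UNIV_I])
    then show "x \<in> \<Union>{B. bisection B}" by blast
  qed
  from compactE[OF assms this] obtain \<F> where "\<F> \<subseteq> {B. bisection B}" "finite \<F>" "K \<subseteq> \<Union>\<F>"
    by (metis bisection_def mem_Collect_eq)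
  then show ?thesis using that by (metis Ball_Collect)
qed

end

section \<open>Continuous functions with compact support\<close>

lemma CcI:
  fixes f :: "'g::t2_space \<Rightarrow> complex"
  assumes "continuous_on UNIV f" "compact K" "\<And>x. f x \<noteq> 0 \<Longrightarrow> x \<in> K"
  shows "f \<in> Cc"
proof -
  have "closure {x. f x \<noteq> 0} \<subseteq> K"
    using assms by (intro closure_minimal compact_imp_closed) auto
  then have "compact (closure {x. f x \<noteq> 0})" using assms(2) by (metis closed_closure compact_Int_closed inf.absorb_iff2)
  then show ?thesis using assms(1) by (simp add: Cc_def)
qed

lemma CcE:
  fixes f :: "'g::t2_space \<Rightarrow> complex"
  assumes "f \<in> Cc"
  obtains K where "compact K" "\<And>x. x \<notin> K \<Longrightarrow> f x = 0"
  using assms closure_subset[of "{x. f x \<noteq> 0}"] by (auto simp: Cc_def)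

lemma Cc_continuous: "f \<in> Cc \<Longrightarrow> continuous_on A f"
  by (auto simp: Cc_def intro: continuous_on_subset)

lemma Cc_zero [simp]: "(\<lambda>x::'g::t2_space. 0) \<in> Cc"
  by (rule CcI[of _ "{}"]) auto

lemma Cc_add:
  fixes f g :: "'g::t2_space \<Rightarrow> complex"
  assumes "f \<in> Cc" "g \<in> Cc" shows "(\<lambda>x. f x + g x) \<in> Cc"
proof -
  obtain K where K: "compact K" "\<And>x. x \<notin> K \<Longrightarrow> f x = 0" using CcE[OF assms(1)] by metis
  obtain L where L: "compact L" "\<And>x. x \<notin> L \<Longrightarrow> g x = 0" using CcE[OF assms(2)] by metis
  show ?thesis
  proof (rule CcI)
    show "continuous_on UNIV (\<lambda>x. f x + g x)" by (intro continuous_on_add Cc_continuous assms)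
    show "compact (K \<union> L)" using K L by (intro compact_Un)
    show "x \<in> K \<union> L" if "f x + g x \<noteq> 0" for x using that K(2)[of x] L(2)[of x] by force
  qed
qed

lemma Cc_mult_continuous:
  fixes f h :: "'g::t2_space \<Rightarrow> complex"
  assumes "f \<in> Cc" "continuous_on UNIV h" shows "(\<lambda>x. h x * f x) \<in> Cc"
proof -
  obtain K where K: "compact K" "\<And>x. x \<notin> K \<Longrightarrow> f x = 0" using CcE[OF assms(1)] by metis
  show ?thesis
  proof (rule CcI[OF _ K(1)])
    show "continuous_on UNIV (\<lambda>x. h x * f x)" by (intro continuous_on_mult Cc_continuous assms)
    show "x \<in> K" if "h x * f x \<noteq> 0" for x using that K(2)[of x] by auto
  qed
qed

lemma Cc_scale: "f \<in> Cc \<Longrightarrow> (\<lambda>x::'g::t2_space. c * f x) \<in> Cc"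
  by (rule Cc_mult_continuous[OF _ continuous_on_const])

lemma Cc_diff:
  fixes f g :: "'g::t2_space \<Rightarrow> complex"
  assumes "f \<in> Cc" "g \<in> Cc" shows "(\<lambda>x. f x - g x) \<in> Cc"
  using Cc_add[OF assms(1) Cc_scale[OF assms(2), of "-1"]] by simp

lemma continuous_on_indicator_clopen:
  assumes "open V" "closed V" shows "continuous_on A (indicator V :: _ \<Rightarrow> complex)"
proof -
  have "continuous_on (V \<union> - V) (\<lambda>x. if x \<in> V then 1 else 0 :: complex)"
    by (intro continuous_on_cases) (auto simp: assms closed_Compl)
  moreover have "(\<lambda>x. if x \<in> V then 1 else 0) = (indicator V :: _ \<Rightarrow> complex)"
    by (auto simp: fun_eq_iff indicator_def)
  ultimately have "continuous_on UNIV (indicator V :: _ \<Rightarrow> complex)" by (simp only: Compl_partition)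
  then show ?thesis by (rule continuous_on_subset) simp
qed

lemma Cc_indicator:
  "compact V \<Longrightarrow> open V \<Longrightarrow> (indicator V :: 'g::t2_space \<Rightarrow> complex) \<in> Cc"
  by (rule CcI[OF continuous_on_indicator_clopen, of V V])
    (simp_all add: compact_imp_closed indicator_eq_0_iff)

lemma Cc_bounded:
  fixes f :: "'g::t2_space \<Rightarrow> complex"
  assumes "f \<in> Cc"
  obtains M where "\<And>x. cmod (f x) \<le> M"
proof -
  obtain K where K: "compact K" "\<And>x. x \<notin> K \<Longrightarrow> f x = 0" using CcE[OF assms] by metis
  have "compact (f ` K)" using K Cc_continuous[OF assms] by (intro compact_continuous_image)
  then obtain M where M: "\<And>x. x \<in> K \<Longrightarrow> cmod (f x) \<le> M"
    using compact_imp_bounded bounded_iff by (metis image_eqI)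
  have "cmod (f x) \<le> max M 0" for x
  proof (cases "x \<in> K")
    case True
    then show ?thesis using M[of x] by simp
  qed (use K in simp)
  then show ?thesis by (rule that)
qed

section \<open>Fibrewise finiteness and convolution\<close>

context hausdorff_ample_groupoid
begin

lemma Cc_involution:
  assumes "f \<in> Cc" shows "involution G f \<in> Cc"
proof -
  obtain K where K: "compact K" "\<And>x. x \<notin> K \<Longrightarrow> f x = 0" using CcE[OF assms] by metis
  show ?thesis unfolding involution_def
  proof (rule CcI)
    show "continuous_on UNIV (\<lambda>x. cnj (f (ginv G x)))"
      by (intro continuous_intros continuous_on_compose2[OF Cc_continuous[OF assms, of UNIV] continuous_on_ginv]) auto
    show "compact (ginv G ` K)" using K by (intro compact_continuous_image continuous_on_ginv)
    show "x \<in> ginv G ` K" if "cnj (f (ginv G x)) \<noteq> 0" for x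
      using that K(2)[of "ginv G x"] by (intro image_eqI[of _ _ "ginv G x"]) auto
  qed
qed

text \<open>Finitely many bisections cover the support, and each meets a range or source fibre at
  most once. Their number is thus a bound uniform in the fibre; \<beta> assigns to each point of the
  support a bisection containing it.\<close>

lemma Cc_fibre_card:
  assumes "f \<in> Cc"
  shows "\<exists>N. \<forall>u. finite {y. rng G y = u \<and> f y \<noteq> 0} \<and> card {y. rng G y = u \<and> f y \<noteq> 0} \<le> N
    \<and> finite {y. src G y = u \<and> f y \<noteq> 0} \<and> card {y. src G y = u \<and> f y \<noteq> 0} \<le> N"
proof -
  obtain K where K: "compact K" "\<And>x. x \<notin> K \<Longrightarrow> f x = 0" using CcE[OF assms] by metis
  obtain \<F> where \<F>: "finite \<F>" "\<And>B. B \<in> \<F> \<Longrightarrow> bisection B" "K \<subseteq> \<Union>\<F>"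
    using bisection_cover[OF K(1)] by metis
  have *: "finite {y. h y = u \<and> f y \<noteq> 0} \<and> card {y. h y = u \<and> f y \<noteq> 0} \<le> card \<F>"
    if h: "\<And>B. B \<in> \<F> \<Longrightarrow> inj_on h B" for h :: "'g \<Rightarrow> 'g" and u
  proof -
    define \<beta> where "\<beta> y = (SOME B. B \<in> \<F> \<and> y \<in> B)" for y
    have \<beta>: "\<beta> y \<in> \<F> \<and> y \<in> \<beta> y" if "f y \<noteq> 0" for y
      unfolding \<beta>_def by (rule someI_ex) (use that K \<F>(3) in blast)
    have "inj_on \<beta> {y. h y = u \<and> f y \<noteq> 0}"
    proof (rule inj_onI)
      fix y z assume yz: "y \<in> {y. h y = u \<and> f y \<noteq> 0}" "z \<in> {y. h y = u \<and> f y \<noteq> 0}" "\<beta> y = \<beta> z"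
      then have "y \<in> \<beta> y" "z \<in> \<beta> y" "\<beta> y \<in> \<F>" "h y = h z" using \<beta>[of y] \<beta>[of z] by auto
      then show "y = z" using h[of "\<beta> y"] by (auto dest: inj_onD)
    qed
    moreover have "\<beta> ` {y. h y = u \<and> f y \<noteq> 0} \<subseteq> \<F>" using \<beta> by auto
    ultimately show ?thesis using \<F>(1) by (meson card_inj_on_le inj_on_finite)
  qed
  show ?thesis
    using *[of "rng G"] *[of "src G"] \<F>(2) unfolding bisection_def by blast
qed

lemma Cc_finite_fibres:
  assumes "f \<in> Cc"
  shows "finite {y. rng G y = u \<and> f y \<noteq> 0}" "finite {y. src G y = u \<and> f y \<noteq> 0}"
proof -
  obtain N where N: "\<forall>u. finite {y. rng G y = u \<and> f y \<noteq> 0} \<and> card {y. rng G y = u \<and> f y \<noteq> 0} \<le> N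
    \<and> finite {y. src G y = u \<and> f y \<noteq> 0} \<and> card {y. src G y = u \<and> f y \<noteq> 0} \<le> N"
    using Cc_fibre_card[OF assms] by (rule exE)
  show "finite {y. rng G y = u \<and> f y \<noteq> 0}" using spec[OF N, of u] by (elim conjE)
  show "finite {y. src G y = u \<and> f y \<noteq> 0}" using spec[OF N, of u] by (elim conjE)
qed

lemma convolution_eq_sum:
  assumes "finite A" "A \<subseteq> {y. rng G y = rng G x}"
    "\<And>y. rng G y = rng G x \<Longrightarrow> y \<notin> A \<Longrightarrow> f y * g (mult G (ginv G y) x) = 0"
  shows "convolution G f g x = (\<Sum>y\<in>A. f y * g (mult G (ginv G y) x))"
proof -
  have "convolution G f g x = (\<Sum>\<^sub>\<infinity>y\<in>A. f y * g (mult G (ginv G y) x))"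
    unfolding convolution_def by (rule infsum_cong_neutral) (use assms(2) in blast, use assms(3) in blast, rule refl)
  then show ?thesis using assms(1) by simp
qed

lemma convolution_eq_single:
  assumes "rng G y = rng G x"
    "\<And>z. rng G z = rng G x \<Longrightarrow> z \<noteq> y \<Longrightarrow> f z * g (mult G (ginv G z) x) = 0"
  shows "convolution G f g x = f y * g (mult G (ginv G y) x)"
proof -
  have "convolution G f g x = (\<Sum>z\<in>{y}. f z * g (mult G (ginv G z) x))"
    by (rule convolution_eq_sum) (simp, use assms(1) in simp, use assms(2) in blast)
  then show ?thesis by simp
qed

lemma convolution_eq_0:
  assumes "\<And>z. rng G z = rng G x \<Longrightarrow> f z * g (mult G (ginv G z) x) = 0"
  shows "convolution G f g x = 0"
proof -
  have "convolution G f g x = (\<Sum>z\<in>{}. f z * g (mult G (ginv G z) x))"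
    by (rule convolution_eq_sum) (simp, simp, use assms in blast)
  then show ?thesis by simp
qed

lemma convolution_add_left:
  assumes "f \<in> Cc" "f' \<in> Cc"
  shows "convolution G (\<lambda>x. f x + f' x) g = (\<lambda>x. convolution G f g x + convolution G f' g x)"
proof
  fix x
  let ?A = "{y. rng G y = rng G x \<and> f y \<noteq> 0} \<union> {y. rng G y = rng G x \<and> f' y \<noteq> 0}"
  have "finite ?A" by (intro finite_UnI Cc_finite_fibres assms)
  then have eq: "convolution G h g x = (\<Sum>y\<in>?A. h y * g (mult G (ginv G y) x))"
    if "\<And>y. f y = 0 \<Longrightarrow> f' y = 0 \<Longrightarrow> h y = 0" for h
    by (rule convolution_eq_sum) (use that in \<open>blast, simp\<close>)
  show "convolution G (\<lambda>x. f x + f' x) g x = convolution G f g x + convolution G f' g x"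
    by (simp add: eq distrib_right sum.distrib)
qed

text \<open>Over a given range there is at most one \<open>y\<close> in \<open>B\<close>, namely
  \<sigma> of that range, so the convolution sum collapses to a single product. The set
  \<open>D\<close> where such a \<open>y\<close> exists is clopen, so extending by zero stays
  continuous.\<close>

lemma Cc_convolution_bisection:
  assumes B: "bisection B" and f: "f \<in> Cc" "\<And>x. x \<notin> B \<Longrightarrow> f x = 0" and g: "g \<in> Cc"
  shows "convolution G f g \<in> Cc"
proof -
  define \<sigma> where "\<sigma> = the_inv_into B (rng G)"
  have B': "compact B" "open B" "inj_on (rng G) B" using B by (auto simp: bisection_def)
  have \<sigma>: "\<sigma> (rng G y) = y" if "y \<in> B" for y
    using that B' by (simp add: \<sigma>_def the_inv_into_f_f)
  have cont\<sigma>: "continuous_on (rng G ` B) \<sigma>"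
    using \<sigma> B' by (intro continuous_on_inv continuous_on_rng) auto
  define D where "D = rng G -` (rng G ` B)"
  have V: "compact_open_units (rng G ` B)" using B by (rule compact_open_units_rng)
  have D: "open D" "closed D" unfolding D_def
    using compact_open_unitsD[OF V] by (auto intro: open_vimage_rng closed_vimage_rng)
  have eq: "convolution G f g x =
      (if x \<in> D then f (\<sigma> (rng G x)) * g (mult G (ginv G (\<sigma> (rng G x))) x) else 0)" for x
  proof (cases "x \<in> D")
    case True
    then obtain y where y: "y \<in> B" "rng G x = rng G y" by (auto simp: D_def)
    have "convolution G f g x = f y * g (mult G (ginv G y) x)"
    proof (rule convolution_eq_single)
      show "f z * g (mult G (ginv G z) x) = 0" if "rng G z = rng G x" "z \<noteq> y" for z
        using f(2)[of z] y B'(3) that by (auto dest: inj_onD)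
    qed (use y in auto)
    then show ?thesis using True y \<sigma> by simp
  next
    case False
    have "convolution G f g x = 0"
    proof (rule convolution_eq_0)
      fix z assume "rng G z = rng G x"
      then have "z \<notin> B" using False unfolding D_def by (metis image_eqI vimage_eq)
      then show "f z * g (mult G (ginv G z) x) = 0" using f(2) by simp
    qed
    then show ?thesis using False by simp
  qed
  obtain K where K: "compact K" "\<And>x. x \<notin> K \<Longrightarrow> g x = 0" using CcE[OF g] by metis
  \<comment> \<open>The product set of \<open>B\<close> and \<open>K\<close>. It is compact because
    composable pairs form a closed set, and it contains the support of the convolution.\<close>
  define L where "L = (\<lambda>(y, z). mult G y z) ` ((B \<times> K) \<inter> {p. src G (fst p) = rng G (snd p)})"
  have "closed {p. src G (fst p) = rng G (snd p)}"
    by (intro closed_Collect_eq continuous_on_compose2[OF continuous_on_src] 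
        continuous_on_compose2[OF continuous_on_rng] continuous_intros) auto
  then have "compact L" unfolding L_def using B' K
    by (intro compact_continuous_image compact_Int_closed compact_Times continuous_on_subset[OF mult_continuous]) auto
  show ?thesis
  proof (rule CcI[OF _ \<open>compact L\<close>])
    have s: "continuous_on D (\<lambda>x. \<sigma> (rng G x))"
      by (rule continuous_on_compose2[OF cont\<sigma> continuous_on_rng]) (auto simp: D_def)
    have "continuous_on D (\<lambda>x. f (\<sigma> (rng G x)) * g (mult G (ginv G (\<sigma> (rng G x))) x))"
    proof (rule Limits.continuous_on_mult)
      show "continuous_on D (\<lambda>x. f (\<sigma> (rng G x)))"
        by (rule continuous_on_compose2[OF Cc_continuous[OF f(1), of UNIV] s]) auto
      have "continuous_on D (\<lambda>x. mult G (ginv G (\<sigma> (rng G x))) x)"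
        using \<sigma> by (intro continuous_on_mult continuous_on_compose2[OF continuous_on_ginv s] continuous_on_id)
          (auto simp: src_ginv D_def)
      then show "continuous_on D (\<lambda>x. g (mult G (ginv G (\<sigma> (rng G x))) x))"
        by (rule continuous_on_compose2[OF Cc_continuous[OF g, of UNIV]]) auto
    qed
    then have "continuous_on (D \<union> - D)
      (\<lambda>x. if x \<in> D then f (\<sigma> (rng G x)) * g (mult G (ginv G (\<sigma> (rng G x))) x) else 0)"
      using D by (intro continuous_on_cases) auto
    then show "continuous_on UNIV (convolution G f g)" unfolding eq[abs_def] by simp
    show "x \<in> L" if "convolution G f g x \<noteq> 0" for x
    proof -
      have "x \<in> D" and g0: "g (mult G (ginv G (\<sigma> (rng G x))) x) \<noteq> 0" using that eq[of x] by (auto split: if_splits)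
      then obtain y where y: "y \<in> B" "rng G x = rng G y" by (auto simp: D_def)
      then have "mult G (ginv G y) x \<in> K" using g0 K \<sigma> by auto
      then show ?thesis unfolding L_def using y
        by (intro image_eqI[of _ _ "(y, mult G (ginv G y) x)"])
          (auto simp: mult_ginv_mult rng_mult rng_ginv src_ginv)
    qed
  qed
qed

text \<open>Compact open bisections are clopen, so multiplying by their indicators preserves
  continuity. This peels from \<open>f\<close>, one at a time, pieces supported in single
  bisections.\<close>

lemma Cc_convolution:
  assumes f: "f \<in> Cc" and g: "g \<in> Cc"
  shows "convolution G f g \<in> Cc"
proof -
  have *: "convolution G f g \<in> Cc"
    if "finite \<F>" "\<And>B. B \<in> \<F> \<Longrightarrow> bisection B" "f \<in> Cc" "\<And>x. x \<notin> \<Union>\<F> \<Longrightarrow> f x = 0" for \<F> f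
    using that
  proof (induction \<F> arbitrary: f rule: finite_induct)
    case empty
    have "convolution G f g = (\<lambda>x. 0)"
      using empty by (simp add: convolution_def)
    then show ?case by simp
  next
    case (insert B \<F>)
    have B: "bisection B" using insert by simp
    then have B': "open B" "closed B" by (auto simp: bisection_def compact_imp_closed)
    have 1: "(\<lambda>x. indicator B x * f x) \<in> Cc"
      using B' insert by (intro Cc_mult_continuous continuous_on_indicator_clopen)
    have 2: "(\<lambda>x. indicator (- B) x * f x) \<in> Cc"
      using B' insert by (intro Cc_mult_continuous continuous_on_indicator_clopen) auto
    have "f = (\<lambda>x. indicator B x * f x + indicator (- B) x * f x)"
      by (auto simp: fun_eq_iff indicator_def)
    then have "convolution G f g = convolution G (\<lambda>x. indicator B x * f x + indicator (- B) x * f x) g"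
      by simp
    also have "\<dots> = (\<lambda>x. convolution G (\<lambda>x. indicator B x * f x) g x + convolution G (\<lambda>x. indicator (- B) x * f x) g x)"
      by (rule convolution_add_left[OF 1 2])
    also have "\<dots> \<in> Cc"
    proof (rule Cc_add)
      show "convolution G (\<lambda>x. indicator B x * f x) g \<in> Cc"
        by (rule Cc_convolution_bisection[OF B 1 _ g]) simp
      show "convolution G (\<lambda>x. indicator (- B) x * f x) g \<in> Cc"
      proof (rule insert.IH[OF _ 2])
        show "indicator (- B) x * f x = 0" if "x \<notin> \<Union>\<F>" for x
          using insert.prems(3)[of x] that by (cases "x \<in> B") auto
      qed (use insert.prems in auto)
    qed
    finally show ?case .
  qed
  obtain K where K: "compact K" "\<And>x. x \<notin> K \<Longrightarrow> f x = 0" using CcE[OF f] by metis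
  obtain \<F> where \<F>: "finite \<F>" "\<And>B. B \<in> \<F> \<Longrightarrow> bisection B" "K \<subseteq> \<Union>\<F>"
    using bisection_cover[OF K(1)] by metis
  show ?thesis by (rule *[OF \<F>(1) \<F>(2) f]) (use K(2) \<F>(3) in blast)+
qed

lemma convolution_indicator_left:
  assumes "V \<subseteq> units G"
  shows "convolution G (indicator V) f = (\<lambda>x. indicator V (rng G x) * f x)"
proof
  fix x
  have "convolution G (indicator V) f x = indicator V (rng G x) * f (mult G (ginv G (rng G x)) x)"
  proof (rule convolution_eq_single)
    show "indicator V y * f (mult G (ginv G y) x) = 0" if "rng G y = rng G x" "y \<noteq> rng G x" for y
      using that assms by (auto simp: indicator_def)
  qed auto
  then show "convolution G (indicator V) f x = indicator V (rng G x) * f x"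
    by (simp add: rng_unit rng_mult_left)
qed

lemma convolution_indicator_right:
  assumes "V \<subseteq> units G"
  shows "convolution G f (indicator V) = (\<lambda>x. f x * indicator V (src G x))"
proof
  fix x
  have "convolution G f (indicator V) x = f x * indicator V (mult G (ginv G x) x)"
  proof (rule convolution_eq_single)
    show "f y * indicator V (mult G (ginv G y) x) = 0" if y: "rng G y = rng G x" "y \<noteq> x" for y
    proof -
      \<comment> \<open>The product of \<open>ginv G y\<close> and \<open>x\<close> can be a unit
        only for \<open>y = x\<close>, so the sum has just one nonzero term.\<close>
      have "mult G (ginv G y) x \<notin> V"
      proof
        assume "mult G (ginv G y) x \<in> V"
        then have "mult G (ginv G y) x = rng G (mult G (ginv G y) x)" using assms by auto
        also have "\<dots> = src G y" using y by (simp add: rng_mult rng_ginv src_ginv)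
        finally have "mult G y (mult G (ginv G y) x) = y" by (simp add: mult_src_right)
        then show False using y by (simp add: mult_ginv_mult)
      qed
      then show ?thesis by simp
    qed
  qed auto
  then show "convolution G f (indicator V) x = f x * indicator V (src G x)"
    by (simp add: ginv_left)
qed

lemma involution_indicator_units:
  assumes "V \<subseteq> units G" shows "involution G (indicator V) = indicator V"
proof
  fix x
  have "ginv G x \<in> V \<longleftrightarrow> x \<in> V" using assms by (metis ginv_ginv ginv_of_unit subsetD)
  then show "involution G (indicator V) x = indicator V x"
    by (simp add: involution_def indicator_def)
qed

text \<open>A product of \<open>z\<close> in \<open>B\<close> with the inverse of \<open>w\<close>
  in \<open>B\<close> requires equal sources, hence \<open>z = w\<close>, and is then the unit
  \<open>rng G z\<close>. Injectivity of the range leaves one term over each such unit.\<close>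

lemma convolution_bisection_involution:
  assumes B: "bisection B"
  shows "convolution G (indicator B) (involution G (indicator B)) = indicator (rng G ` B)"
proof
  fix x
  have inj: "inj_on (rng G) B" "inj_on (src G) B" using B by (auto simp: bisection_def)
  show "convolution G (indicator B) (involution G (indicator B)) x = indicator (rng G ` B) x"
  proof (cases "x \<in> rng G ` B")
    case True
    then obtain y where y: "y \<in> B" "x = rng G y" by auto
    have "convolution G (indicator B) (involution G (indicator B)) x
        = indicator B y * involution G (indicator B) (mult G (ginv G y) x)"
    proof (rule convolution_eq_single)
      show "indicator B z * involution G (indicator B) (mult G (ginv G z) x) = 0"
        if "rng G z = rng G x" "z \<noteq> y" for z
        using that y inj by (auto simp: indicator_def dest: inj_onD)
    qed (use y in auto)
    also have "mult G (ginv G y) x = ginv G y"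
      using y mult_src_right[of "ginv G y"] by (simp add: src_ginv)
    finally show ?thesis using y True by (simp add: involution_def)
  next
    case False
    have "convolution G (indicator B) (involution G (indicator B)) x = 0"
    proof (rule convolution_eq_0)
      show "indicator B z * involution G (indicator B) (mult G (ginv G z) x) = 0"
        if z: "rng G z = rng G x" for z
      proof (rule ccontr)
        assume "\<not> ?thesis"
        then have zB: "z \<in> B" "ginv G (mult G (ginv G z) x) \<in> B"
          by (auto simp: involution_def indicator_def split: if_splits)
        have "ginv G (mult G (ginv G z) x) = mult G (ginv G x) z"
          using z by (simp add: ginv_mult src_ginv)
        moreover have "src G (mult G (ginv G x) z) = src G z" using z by (simp add: src_mult src_ginv)
        ultimately have e: "mult G (ginv G x) z = z" using zB inj(2) by (metis inj_onD)
        have "ginv G x = mult G (mult G (ginv G x) z) (ginv G z)"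
          using z by (simp add: mult_mult_ginv src_ginv)
        also have "\<dots> = rng G z" by (simp add: e ginv_right)
        finally have "x = rng G z" by (metis ginv_ginv ginv_of_unit rng_unit)
        then show False using False zB by blast
      qed
    qed
    then show ?thesis using False by simp
  qed
qed

text \<open>The value at \<open>v\<close> is the sum of the squared moduli of \<open>f\<close> over
  the source fibre of \<open>v\<close>. A large value of \<open>f\<close> anywhere thus becomes a
  large value at a unit.\<close>

lemma convolution_involution_unit:
  assumes f: "f \<in> Cc" and v: "v \<in> units G"
  obtains r where "convolution G (involution G f) f v = complex_of_real r" "r \<ge> 0"
    "\<And>z. src G z = v \<Longrightarrow> (cmod (f z))\<^sup>2 \<le> r"
proof -
  define A where "A = {z. src G z = v \<and> f z \<noteq> 0}"
  have fin: "finite A" unfolding A_def by (rule Cc_finite_fibres[OF f])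
  have "convolution G (involution G f) f v
      = (\<Sum>y\<in>ginv G ` A. involution G f y * f (mult G (ginv G y) v))"
  proof (rule convolution_eq_sum)
    show "ginv G ` A \<subseteq> {y. rng G y = rng G v}" using v by (auto simp: A_def rng_ginv)
    show "involution G f y * f (mult G (ginv G y) v) = 0" if "rng G y = rng G v" "y \<notin> ginv G ` A" for y
    proof -
      have "src G (ginv G y) = v" using that v by (simp add: src_ginv)
      moreover have "ginv G y \<notin> A" using that(2) by (metis ginv_ginv image_eqI)
      ultimately show ?thesis by (simp add: A_def involution_def)
    qed
  qed (use fin in auto)
  also have "\<dots> = (\<Sum>z\<in>A. involution G f (ginv G z) * f (mult G (ginv G (ginv G z)) v))"
    by (rule sum.reindex[unfolded comp_def]) (metis ginv_ginv inj_onI)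
  also have "\<dots> = (\<Sum>z\<in>A. complex_of_real ((cmod (f z))\<^sup>2))"
  proof (rule sum.cong)
    fix z assume "z \<in> A"
    then have "mult G z v = z" using mult_src_right[of z] by (simp add: A_def)
    then show "involution G f (ginv G z) * f (mult G (ginv G (ginv G z)) v) = complex_of_real ((cmod (f z))\<^sup>2)"
      by (simp only: involution_def complex_norm_square ginv_ginv mult.commute)
  qed simp
  also have "\<dots> = complex_of_real (\<Sum>z\<in>A. (cmod (f z))\<^sup>2)" by simp
  finally have eq: "convolution G (involution G f) f v = complex_of_real (\<Sum>z\<in>A. (cmod (f z))\<^sup>2)" .
  show ?thesis
  proof (rule that[OF eq])
    show "0 \<le> (\<Sum>z\<in>A. (cmod (f z))\<^sup>2)" by (simp add: sum_nonneg)
    show "(cmod (f z))\<^sup>2 \<le> (\<Sum>z\<in>A. (cmod (f z))\<^sup>2)" if "src G z = v" for z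
    proof (cases "f z = 0")
      case False
      then show ?thesis using fin that by (intro member_le_sum) (auto simp: A_def)
    qed (simp add: sum_nonneg)
  qed
qed

end

section \<open>The reduced norm\<close>

lemma ell2_bounded:
  assumes "\<And>x. x \<notin> S \<Longrightarrow> \<xi> x = 0" "0 \<le> C"
    and bound: "\<And>F. finite F \<Longrightarrow> F \<subseteq> S \<Longrightarrow> (\<Sum>x\<in>F. (cmod (\<xi> x))\<^sup>2) \<le> C\<^sup>2"
  shows "\<xi> \<in> ell2 S" "ell2_norm S \<xi> \<le> C"
proof -
  have summ: "(\<lambda>x. (cmod (\<xi> x))\<^sup>2) summable_on S"
    by (rule nonneg_bdd_above_summable_on) (auto intro!: bdd_aboveI2[of _ _ "C\<^sup>2"] bound)
  then show "\<xi> \<in> ell2 S" using assms by (simp add: ell2_def)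
  have "(\<Sum>\<^sub>\<infinity>x\<in>S. (cmod (\<xi> x))\<^sup>2) \<le> C\<^sup>2"
    using summ bound by (rule infsum_le_finite_sums)
  then show "ell2_norm S \<xi> \<le> C"
    unfolding ell2_norm_def using \<open>0 \<le> C\<close> by (metis real_le_lsqrt)
qed

lemma finite_sum_le_ell2_norm:
  assumes "\<xi> \<in> ell2 S" "finite F" "F \<subseteq> S"
  shows "(\<Sum>x\<in>F. (cmod (\<xi> x))\<^sup>2) \<le> (ell2_norm S \<xi>)\<^sup>2"
proof -
  have "(\<Sum>x\<in>F. (cmod (\<xi> x))\<^sup>2) \<le> (\<Sum>\<^sub>\<infinity>x\<in>S. (cmod (\<xi> x))\<^sup>2)"
    using assms by (intro finite_sum_le_infsum) (auto simp: ell2_def)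
  then show ?thesis by (simp add: ell2_norm_def infsum_nonneg)
qed

lemma ell2_coeff_le:
  assumes "\<xi> \<in> ell2 S" "ell2_norm S \<xi> \<le> 1"
  shows "cmod (\<xi> x) \<le> 1"
proof (cases "x \<in> S")
  case True
  have "ell2_norm S \<xi> \<ge> 0" by (simp add: ell2_norm_def infsum_nonneg)
  then have "(ell2_norm S \<xi>)\<^sup>2 \<le> 1" using assms(2) by (simp add: power_le_one)
  then have "(cmod (\<xi> x))\<^sup>2 \<le> 1" using finite_sum_le_ell2_norm[OF assms(1), of "{x}"] True by simp
  then show ?thesis by (simp add: power_le_one_iff)
qed (use assms in \<open>simp add: ell2_def\<close>)

lemma ell2_restrict:
  assumes "\<xi> \<in> ell2 S" "ell2_norm S \<xi> \<le> 1"
  shows "(\<lambda>x. if x \<in> X then \<xi> x else 0) \<in> ell2 S" "ell2_norm S (\<lambda>x. if x \<in> X then \<xi> x else 0) \<le> 1"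
proof -
  define \<xi>' where "\<xi>' = (\<lambda>x. if x \<in> X then \<xi> x else 0)"
  have b: "(\<Sum>x\<in>F. (cmod (\<xi>' x))\<^sup>2) \<le> 1\<^sup>2" if F: "finite F" "F \<subseteq> S" for F
  proof -
    have "(\<Sum>x\<in>F. (cmod (\<xi>' x))\<^sup>2) \<le> (\<Sum>x\<in>F. (cmod (\<xi> x))\<^sup>2)"
      by (rule sum_mono) (simp add: \<xi>'_def)
    also have "\<dots> \<le> (ell2_norm S \<xi>)\<^sup>2" by (rule finite_sum_le_ell2_norm[OF assms(1) F])
    also have "\<dots> \<le> 1\<^sup>2" using assms(2) by (intro power_mono) (simp_all add: ell2_norm_def infsum_nonneg)
    finally show ?thesis .
  qed
  have z: "\<xi>' x = 0" if "x \<notin> S" for x using assms(1) that by (simp add: \<xi>'_def ell2_def)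
  show "(\<lambda>x. if x \<in> X then \<xi> x else 0) \<in> ell2 S" "ell2_norm S (\<lambda>x. if x \<in> X then \<xi> x else 0) \<le> 1"
    using ell2_bounded[OF z _ b] unfolding \<xi>'_def by auto
qed

lemma delta_ell2:
  assumes "x \<in> S" shows "delta x \<in> ell2 S" "ell2_norm S (delta x) \<le> 1"
proof -
  have b: "(\<Sum>y\<in>F. (cmod (delta x y))\<^sup>2) \<le> 1\<^sup>2" if F: "finite F" "F \<subseteq> S" for F
  proof -
    have "(\<Sum>y\<in>F. (cmod (delta x y))\<^sup>2) = (\<Sum>y\<in>F. if y = x then 1 else 0)"
      by (rule sum.cong) (auto simp: delta_def)
    also have "\<dots> \<le> 1" using F(1) by simp
    finally show ?thesis by simp
  qed
  have z: "delta x y = 0" if "y \<notin> S" for y using assms that by (auto simp: delta_def)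
  show "delta x \<in> ell2 S" "ell2_norm S (delta x) \<le> 1" using ell2_bounded[OF z _ b] by auto
qed

section \<open>The regular representations and bounds for their norms\<close>

context groupoid
begin

lemma inj_on_mult_ginv: "inj_on (\<lambda>x. mult G z (ginv G x)) {x. src G x = src G z}"
proof (rule inj_onI)
  fix x y assume xy: "x \<in> {x. src G x = src G z}" "y \<in> {x. src G x = src G z}"
    and eq: "mult G z (ginv G x) = mult G z (ginv G y)"
  have "src G z = rng G (ginv G x)" "src G z = rng G (ginv G y)" using xy by (simp_all add: rng_ginv)
  then have "ginv G x = ginv G y"
    using eq ginv_mult_mult[of z "ginv G x"] ginv_mult_mult[of z "ginv G y"] by metis
  then show "x = y" by (metis ginv_ginv)
qed

lemma inj_on_mult_right: "inj_on (\<lambda>z. mult G z (ginv G x)) {z. src G z = src G x}"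
proof (rule inj_onI)
  fix w z assume wz: "w \<in> {z. src G z = src G x}" "z \<in> {z. src G z = src G x}"
    and eq: "mult G w (ginv G x) = mult G z (ginv G x)"
  have "mult G (mult G w (ginv G x)) x = w" "mult G (mult G z (ginv G x)) x = z"
    using wz by (auto intro: mult_ginv_cancel)
  with eq show "w = z" by metis
qed

end

context hausdorff_ample_groupoid
begin

text \<open>For \<open>x\<close> and \<open>z\<close> in one source fibre, \<open>y x = z\<close>
  has the unique solution \<open>y = z x^-1\<close>. The operator is thus given by the matrix with
  entries \<open>f (z x^-1)\<close>.\<close>

lemma regular_rep_eq:
  assumes "src G z = u"
  shows "regular_rep G u f \<xi> z = (\<Sum>\<^sub>\<infinity>x\<in>source_fibre G u. \<xi> x * f (mult G z (ginv G x)))"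
  unfolding regular_rep_def
proof (rule infsum_cong)
  fix x assume "x \<in> source_fibre G u"
  then have x: "src G z = src G x" using assms by (simp add: source_fibre_def)
  let ?y = "mult G z (ginv G x)"
  have y: "src G ?y = rng G x" using x by (simp add: src_mult rng_ginv src_ginv)
  have "(\<Sum>\<^sub>\<infinity>y\<in>{y. src G y = rng G x}. f y * delta (mult G y x) z)
      = (\<Sum>\<^sub>\<infinity>y\<in>{?y}. f y * delta (mult G y x) z)"
  proof (rule infsum_cong_neutral)
    fix w assume w: "w \<in> {y. src G y = rng G x} - {?y}"
    then have "z \<noteq> mult G w x" using mult_mult_ginv[of w x] by auto
    then show "f w * delta (mult G w x) z = 0" by (simp add: delta_def)
  qed (use y in auto)
  also have "\<dots> = f ?y" using mult_ginv_cancel[OF x] by (simp add: delta_def)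
  finally show "\<xi> x * (\<Sum>\<^sub>\<infinity>y\<in>{y. src G y = rng G x}. f y * delta (mult G y x) z) = \<xi> x * f ?y"
    by simp
qed

lemma regular_rep_eq_sum:
  assumes "src G z = u" "finite X" "X \<subseteq> source_fibre G u"
    "\<And>x. x \<in> source_fibre G u \<Longrightarrow> x \<notin> X \<Longrightarrow> \<xi> x * f (mult G z (ginv G x)) = 0"
  shows "regular_rep G u f \<xi> z = (\<Sum>x\<in>X. \<xi> x * f (mult G z (ginv G x)))"
proof -
  have "regular_rep G u f \<xi> z = (\<Sum>\<^sub>\<infinity>x\<in>X. \<xi> x * f (mult G z (ginv G x)))"
    unfolding regular_rep_eq[OF assms(1)]
    by (rule infsum_cong_neutral) (use assms(3) in blast, use assms(4) in blast, rule refl)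
  then show ?thesis using assms(2) by simp
qed

lemma regular_rep_outside:
  assumes "src G z \<noteq> u" shows "regular_rep G u f \<xi> z = 0"
proof -
  have "delta (mult G y x) z = 0" if "src G x = u" "src G y = rng G x" for x y
    using that assms by (auto simp: delta_def src_mult)
  then have "(\<Sum>\<^sub>\<infinity>y\<in>{y. src G y = rng G x}. f y * delta (mult G y x) z) = 0" if "src G x = u" for x
    using that by (intro infsum_0) auto
  then show ?thesis unfolding regular_rep_def by (intro infsum_0) (simp add: source_fibre_def)
qed

text \<open>The estimate is Schur's test.\<close>

lemma regular_rep_bound:
  assumes f: "\<And>y. cmod (f y) \<le> M"
    and r: "\<And>v. finite {y. rng G y = v \<and> f y \<noteq> 0}" "\<And>v. card {y. rng G y = v \<and> f y \<noteq> 0} \<le> N"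
    and s: "\<And>v. finite {y. src G y = v \<and> f y \<noteq> 0}" "\<And>v. card {y. src G y = v \<and> f y \<noteq> 0} \<le> N"
    and \<xi>: "\<xi> \<in> ell2 (source_fibre G u)" "ell2_norm (source_fibre G u) \<xi> \<le> 1"
    and F: "finite F" "F \<subseteq> source_fibre G u"
  shows "(\<Sum>z\<in>F. (cmod (regular_rep G u f \<xi> z))\<^sup>2) \<le> (real N * M)\<^sup>2"
proof -
  \<comment> \<open>\<open>X z\<close> and \<open>Z x\<close> index the nonzero entries in row
    \<open>z\<close> and column \<open>x\<close> of the matrix. Both embed into fibres of the
    support of \<open>f\<close>, so each has at most \<open>N\<close> elements.\<close>
  define X where "X z = {x. src G x = u \<and> f (mult G z (ginv G x)) \<noteq> 0}" for z
  define Z where "Z x = {z. src G z = u \<and> f (mult G z (ginv G x)) \<noteq> 0}" for x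
  have "M \<ge> 0" using f[of undefined] norm_ge_zero order_trans by blast
  have X: "finite (X z)" "card (X z) \<le> N" if z: "src G z = u" for z
  proof -
    have inj: "inj_on (\<lambda>x. mult G z (ginv G x)) (X z)"
      by (rule inj_on_subset[OF inj_on_mult_ginv]) (auto simp: X_def z)
    have sub: "(\<lambda>x. mult G z (ginv G x)) ` X z \<subseteq> {y. rng G y = rng G z \<and> f y \<noteq> 0}"
      using z by (auto simp: X_def rng_mult rng_ginv)
    show "finite (X z)" using inj_on_finite[OF inj sub r(1)] .
    show "card (X z) \<le> N" by (rule order_trans[OF card_inj_on_le[OF inj sub r(1)] r(2)])
  qed
  have Z: "finite (Z x)" "card (Z x) \<le> N" if x: "src G x = u" for x
  proof -
    have inj: "inj_on (\<lambda>z. mult G z (ginv G x)) (Z x)"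
      by (rule inj_on_subset[OF inj_on_mult_right]) (auto simp: Z_def x)
    have sub: "(\<lambda>z. mult G z (ginv G x)) ` Z x \<subseteq> {y. src G y = rng G x \<and> f y \<noteq> 0}"
      using x by (auto simp: Z_def src_mult rng_ginv src_ginv)
    show "finite (Z x)" using inj_on_finite[OF inj sub s(1)] .
    show "card (Z x) \<le> N" by (rule order_trans[OF card_inj_on_le[OF inj sub s(1)] s(2)])
  qed
  define A where "A = (\<Union>z\<in>F. X z)"
  have Fu: "src G z = u" if "z \<in> F" for z using F(2) that by (auto simp: source_fibre_def)
  have A: "finite A" "A \<subseteq> source_fibre G u"
    using F(1) X(1) Fu by (auto simp: A_def X_def source_fibre_def)
  have pw: "(cmod (regular_rep G u f \<xi> z))\<^sup>2 \<le> N * M\<^sup>2 * (\<Sum>x\<in>X z. (cmod (\<xi> x))\<^sup>2)" if z: "z \<in> F" for z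
  proof -
    have "cmod (regular_rep G u f \<xi> z) = cmod (\<Sum>x\<in>X z. \<xi> x * f (mult G z (ginv G x)))"
    proof (subst regular_rep_eq_sum)
      show "\<xi> x * f (mult G z (ginv G x)) = 0" if "x \<in> source_fibre G u" "x \<notin> X z" for x
        using that by (simp add: X_def source_fibre_def)
    qed (use Fu[OF z] X(1) in \<open>auto simp: X_def source_fibre_def\<close>)
    also have "\<dots> \<le> (\<Sum>x\<in>X z. cmod (\<xi> x) * M)"
      by (rule order_trans[OF norm_sum]) (simp add: sum_mono norm_mult mult_left_mono f)
    finally have "(cmod (regular_rep G u f \<xi> z))\<^sup>2 \<le> (\<Sum>x\<in>X z. cmod (\<xi> x) * M)\<^sup>2"
      by (rule power_mono) simp
    also have "\<dots> \<le> (\<Sum>x\<in>X z. (cmod (\<xi> x) * M)\<^sup>2) * card (X z)"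
      by (rule sum_squared_le_sum_of_squares)
    also have "\<dots> \<le> (\<Sum>x\<in>X z. (cmod (\<xi> x) * M)\<^sup>2) * N"
      using X(2)[OF Fu[OF z]] by (intro mult_left_mono) (auto simp: sum_nonneg)
    also have "\<dots> = N * M\<^sup>2 * (\<Sum>x\<in>X z. (cmod (\<xi> x))\<^sup>2)"
      by (simp add: power_mult_distrib sum_distrib_left mult_ac)
    finally show ?thesis .
  qed
  have "(\<Sum>z\<in>F. (cmod (regular_rep G u f \<xi> z))\<^sup>2) \<le> (\<Sum>z\<in>F. N * M\<^sup>2 * (\<Sum>x\<in>X z. (cmod (\<xi> x))\<^sup>2))"
    by (rule sum_mono) (rule pw)
  also have "\<dots> = N * M\<^sup>2 * (\<Sum>z\<in>F. \<Sum>x\<in>X z. (cmod (\<xi> x))\<^sup>2)" by (simp add: sum_distrib_left)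
  \<comment> \<open>Cauchy-Schwarz has cost one factor \<open>N\<close> for the row length;
    exchanging the sums costs a second one for the column length.\<close>
  also have "(\<Sum>z\<in>F. \<Sum>x\<in>X z. (cmod (\<xi> x))\<^sup>2) = (\<Sum>z\<in>F. \<Sum>x\<in>{x \<in> A. x \<in> X z}. (cmod (\<xi> x))\<^sup>2)"
    by (intro sum.cong refl) (auto simp: A_def)
  also have "\<dots> = (\<Sum>x\<in>A. \<Sum>z\<in>{z \<in> F. x \<in> X z}. (cmod (\<xi> x))\<^sup>2)"
    using F(1) A(1) by (rule sum.swap_restrict)
  also have "\<dots> \<le> (\<Sum>x\<in>A. N * (cmod (\<xi> x))\<^sup>2)"
  proof (rule sum_mono)
    fix x assume "x \<in> A"
    then have x: "src G x = u" using A(2) by (auto simp: source_fibre_def)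
    have "{z \<in> F. x \<in> X z} \<subseteq> Z x" using Fu by (auto simp: X_def Z_def)
    then have "card {z \<in> F. x \<in> X z} \<le> N" using card_mono[OF Z(1)[OF x]] Z(2)[OF x] by (meson order_trans)
    then show "(\<Sum>z\<in>{z \<in> F. x \<in> X z}. (cmod (\<xi> x))\<^sup>2) \<le> N * (cmod (\<xi> x))\<^sup>2"
      by (simp add: mult_right_mono)
  qed
  also have "\<dots> = N * (\<Sum>x\<in>A. (cmod (\<xi> x))\<^sup>2)" by (simp add: sum_distrib_left)
  also have "\<dots> \<le> real N * 1"
  proof (rule mult_left_mono)
    have "(\<Sum>x\<in>A. (cmod (\<xi> x))\<^sup>2) \<le> (ell2_norm (source_fibre G u) \<xi>)\<^sup>2"
      by (rule finite_sum_le_ell2_norm[OF \<xi>(1) A])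
    also have "\<dots> \<le> 1" using \<xi>(2) by (intro power_le_one) (simp_all add: ell2_norm_def infsum_nonneg)
    finally show "(\<Sum>x\<in>A. (cmod (\<xi> x))\<^sup>2) \<le> 1" .
  qed simp
  finally have "(\<Sum>z\<in>F. (cmod (regular_rep G u f \<xi> z))\<^sup>2) \<le> N * M\<^sup>2 * (N * 1)"
    using \<open>M \<ge> 0\<close> by (simp add: mult_left_mono)
  then show ?thesis by (simp add: power2_eq_square mult_ac)
qed

lemma ell2_unit_ball_nonempty: "{\<xi> \<in> ell2 S. ell2_norm S \<xi> \<le> 1} \<noteq> {}"
proof -
  have "(\<lambda>_. 0) \<in> ell2 S" "ell2_norm S (\<lambda>_. 0) \<le> 1" by (auto simp: ell2_def ell2_norm_def)
  then show ?thesis by blast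
qed

lemma units_nonempty: "units G \<noteq> {}"
  using rng_unit by blast

text \<open>The uniform bound \<open>N * M\<close> also shows that the real suprema run over sets
  bounded above, which the last conclusion requires.\<close>

lemma reduced_norm_le:
  assumes f: "\<And>y. cmod (f y) \<le> M"
    and r: "\<And>v. finite {y. rng G y = v \<and> f y \<noteq> 0}" "\<And>v. card {y. rng G y = v \<and> f y \<noteq> 0} \<le> N"
    and s: "\<And>v. finite {y. src G y = v \<and> f y \<noteq> 0}" "\<And>v. card {y. src G y = v \<and> f y \<noteq> 0} \<le> N"
  shows "reduced_norm G f \<le> real N * M"
    and "\<And>u \<xi>. \<xi> \<in> ell2 (source_fibre G u) \<Longrightarrow> ell2_norm (source_fibre G u) \<xi> \<le> 1 \<Longrightarrow>
      regular_rep G u f \<xi> \<in> ell2 (source_fibre G u)"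
    and "\<And>u \<xi>. u \<in> units G \<Longrightarrow> \<xi> \<in> ell2 (source_fibre G u) \<Longrightarrow> ell2_norm (source_fibre G u) \<xi> \<le> 1 \<Longrightarrow>
      ell2_norm (source_fibre G u) (regular_rep G u f \<xi>) \<le> reduced_norm G f"
proof -
  have "M \<ge> 0" using f[of undefined] norm_ge_zero order_trans by blast
  have b: "regular_rep G u f \<xi> \<in> ell2 (source_fibre G u) \<and>
      ell2_norm (source_fibre G u) (regular_rep G u f \<xi>) \<le> N * M"
    if \<xi>: "\<xi> \<in> ell2 (source_fibre G u)" "ell2_norm (source_fibre G u) \<xi> \<le> 1" for u \<xi>
  proof -
    have "regular_rep G u f \<xi> x = 0" if "x \<notin> source_fibre G u" for x
      using that by (simp add: source_fibre_def regular_rep_outside)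
    then show ?thesis
      using ell2_bounded[of "source_fibre G u" "regular_rep G u f \<xi>" "N * M"]
        regular_rep_bound[OF f r s \<xi>] \<open>M \<ge> 0\<close> by simp
  qed
  have 1: "regular_rep_norm G u f \<le> N * M" for u
    unfolding regular_rep_norm_def
    by (rule cSUP_least[OF ell2_unit_ball_nonempty]) (use b in blast)
  show "reduced_norm G f \<le> N * M"
    unfolding reduced_norm_def by (rule cSUP_least[OF units_nonempty 1])
  show "regular_rep G u f \<xi> \<in> ell2 (source_fibre G u)"
    if "\<xi> \<in> ell2 (source_fibre G u)" "ell2_norm (source_fibre G u) \<xi> \<le> 1" for u \<xi>
    using b that by blast
  show "ell2_norm (source_fibre G u) (regular_rep G u f \<xi>) \<le> reduced_norm G f"
    if "u \<in> units G" and \<xi>: "\<xi> \<in> ell2 (source_fibre G u)" "ell2_norm (source_fibre G u) \<xi> \<le> 1" for u \<xi>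
  proof -
    have "ell2_norm (source_fibre G u) (regular_rep G u f \<xi>) \<le> regular_rep_norm G u f"
      unfolding regular_rep_norm_def
      by (rule cSUP_upper) (use \<xi> b in \<open>auto intro!: bdd_aboveI2[of _ _ "N * M"]\<close>)
    also have "\<dots> \<le> reduced_norm G f" unfolding reduced_norm_def
      by (rule cSUP_upper[OF \<open>u \<in> units G\<close>]) (use 1 in \<open>auto intro!: bdd_aboveI2[of _ _ "N * M"]\<close>)
    finally show ?thesis .
  qed
qed

text \<open>A function living on the units has at most one nonzero value in each fibre, so the
  general bound applies with \<open>N = 1\<close>.\<close>

lemma reduced_norm_supported_units:
  assumes f: "\<And>y. cmod (f y) \<le> M" and "\<And>y. y \<notin> units G \<Longrightarrow> f y = 0"
  shows "reduced_norm G f \<le> M"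
proof -
  have r: "{y. rng G y = v \<and> f y \<noteq> 0} \<subseteq> {v}" and s: "{y. src G y = v \<and> f y \<noteq> 0} \<subseteq> {v}" for v
    using assms(2) by force+
  have "reduced_norm G f \<le> real 1 * M"
    by (rule reduced_norm_le[OF f])
      (use finite_subset[OF r] finite_subset[OF s] card_mono[OF _ r] card_mono[OF _ s] in auto)
  then show ?thesis by simp
qed

text \<open>Lower bounds for the norm are used below only through finitely many coordinates.\<close>

lemma finite_sum_le_reduced_norm:
  assumes "f \<in> Cc" "u \<in> units G"
    and \<xi>: "\<xi> \<in> ell2 (source_fibre G u)" "ell2_norm (source_fibre G u) \<xi> \<le> 1"
    and F: "finite F" "F \<subseteq> source_fibre G u"
  shows "(\<Sum>z\<in>F. (cmod (regular_rep G u f \<xi> z))\<^sup>2) \<le> (reduced_norm G f)\<^sup>2"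
proof -
  obtain M where M: "cmod (f x) \<le> M" for x using Cc_bounded[OF assms(1)] by metis
  obtain N where N: "\<forall>u. finite {y. rng G y = u \<and> f y \<noteq> 0} \<and> card {y. rng G y = u \<and> f y \<noteq> 0} \<le> N
    \<and> finite {y. src G y = u \<and> f y \<noteq> 0} \<and> card {y. src G y = u \<and> f y \<noteq> 0} \<le> N"
    using Cc_fibre_card[OF assms(1)] by (rule exE)
  have "regular_rep G u f \<xi> \<in> ell2 (source_fibre G u)"
    and le: "ell2_norm (source_fibre G u) (regular_rep G u f \<xi>) \<le> reduced_norm G f"
    using reduced_norm_le(2,3)[of f M N] M N assms by auto
  then have "(\<Sum>z\<in>F. (cmod (regular_rep G u f \<xi> z))\<^sup>2)
      \<le> (ell2_norm (source_fibre G u) (regular_rep G u f \<xi>))\<^sup>2"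
    using F by (intro finite_sum_le_ell2_norm)
  also have "\<dots> \<le> (reduced_norm G f)\<^sup>2"
    using le by (intro power_mono) (simp_all add: ell2_norm_def infsum_nonneg)
  finally show ?thesis .
qed

text \<open>Applied to the basis vector at the unit \<open>src G x\<close>, the operator has
  \<open>f x\<close> as its coordinate at \<open>x\<close>. The sign condition allows square roots
  to be taken; it holds later because \<open>norm_iota\<close> identifies the reduced norm with a
  norm.\<close>

lemma cmod_le_reduced_norm:
  assumes "f \<in> Cc" "0 \<le> reduced_norm G f" shows "cmod (f x) \<le> reduced_norm G f"
proof -
  let ?u = "src G x"
  have u: "?u \<in> source_fibre G ?u" "x \<in> source_fibre G ?u" by (simp_all add: source_fibre_def)
  have "regular_rep G ?u f (delta ?u) x = (\<Sum>y\<in>{?u}. delta ?u y * f (mult G x (ginv G y)))"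
    by (rule regular_rep_eq_sum) (use u in \<open>auto simp: delta_def\<close>)
  also have "\<dots> = f x" by (simp add: delta_def src_unit mult_src_right)
  finally have "(cmod (f x))\<^sup>2 \<le> (reduced_norm G f)\<^sup>2"
    using finite_sum_le_reduced_norm[OF assms(1) src_unit delta_ell2[OF u(1)], of "{x}"] u by simp
  then show ?thesis using assms(2) by (simp add: power2_le_iff_abs_le)
qed

text \<open>A norm above \<open>c\<close> is already visible in finitely many coordinates
  \<open>F\<close>, which depend on finitely many entries \<open>X\<close> of the vector. If
  \<open>g\<close> were small everywhere, it would contribute at most \<open>c / 2\<close> to these
  coordinates, and \<open>f - g\<close> at most another \<open>c / 2\<close>. The bound \<kappa> is
  uniform over all such \<open>g\<close>, so that it survives passage to the completion.\<close>

lemma reduced_norm_faithful: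
  assumes f: "f \<in> Cc" and c: "0 < c" "c < reduced_norm G f"
  obtains \<kappa> where "\<kappa> > 0"
    "\<And>g. g \<in> Cc \<Longrightarrow> 0 \<le> reduced_norm G (\<lambda>x. f x - g x) \<Longrightarrow> reduced_norm G (\<lambda>x. f x - g x) \<le> c / 2 \<Longrightarrow>
      \<exists>x. \<kappa> \<le> cmod (g x)"
proof -
  have "\<exists>u \<xi> F. \<xi> \<in> ell2 (source_fibre G u) \<and> ell2_norm (source_fibre G u) \<xi> \<le> 1 \<and> u \<in> units G
      \<and> finite F \<and> F \<subseteq> source_fibre G u \<and> c\<^sup>2 < (\<Sum>z\<in>F. (cmod (regular_rep G u f \<xi> z))\<^sup>2)"
  proof (rule ccontr)
    assume neg: "\<not> ?thesis"
    have "ell2_norm (source_fibre G u) (regular_rep G u f \<xi>) \<le> c"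
      if "u \<in> units G" "\<xi> \<in> ell2 (source_fibre G u)" "ell2_norm (source_fibre G u) \<xi> \<le> 1" for u \<xi>
    proof (rule ell2_bounded(2))
      show "regular_rep G u f \<xi> x = 0" if "x \<notin> source_fibre G u" for x
        using that by (simp add: source_fibre_def regular_rep_outside)
    qed (use neg that c in \<open>auto simp: not_less\<close>)
    then have "regular_rep_norm G u f \<le> c" if "u \<in> units G" for u
      unfolding regular_rep_norm_def using that by (intro cSUP_least[OF ell2_unit_ball_nonempty]) auto
    then have "reduced_norm G f \<le> c" unfolding reduced_norm_def by (intro cSUP_least[OF units_nonempty])
    then show False using c by simp
  qed
  then obtain u \<xi> F where \<xi>: "\<xi> \<in> ell2 (source_fibre G u)" "ell2_norm (source_fibre G u) \<xi> \<le> 1"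
    and u: "u \<in> units G" and F: "finite F" "F \<subseteq> source_fibre G u"
    and big: "c\<^sup>2 < (\<Sum>z\<in>F. (cmod (regular_rep G u f \<xi> z))\<^sup>2)" by blast
  have Fu: "src G z = u" if "z \<in> F" for z using F(2) that by (auto simp: source_fibre_def)
  define X where "X = (\<Union>z\<in>F. {x. src G x = u \<and> f (mult G z (ginv G x)) \<noteq> 0})"
  have "finite {x. src G x = u \<and> f (mult G z (ginv G x)) \<noteq> 0}" if z: "z \<in> F" for z
  proof (rule inj_on_finite[OF _ _ Cc_finite_fibres(1)[OF f, of "rng G z"]])
    show "inj_on (\<lambda>x. mult G z (ginv G x)) {x. src G x = u \<and> f (mult G z (ginv G x)) \<noteq> 0}"
      by (rule inj_on_subset[OF inj_on_mult_ginv]) (auto simp: Fu[OF z])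
    show "(\<lambda>x. mult G z (ginv G x)) ` {x. src G x = u \<and> f (mult G z (ginv G x)) \<noteq> 0}
        \<subseteq> {y. rng G y = rng G z \<and> f y \<noteq> 0}"
      using Fu[OF z] by (auto simp: rng_mult rng_ginv)
  qed
  then have X: "finite X" "X \<subseteq> source_fibre G u" using F by (auto simp: X_def source_fibre_def)
  \<comment> \<open>Truncation leaves the coordinates of \<open>f\<close> in \<open>F\<close>
    unchanged, while those of any other \<open>g\<close> become sums over \<open>X\<close>
    alone.\<close>
  define \<xi>' where "\<xi>' = (\<lambda>x. if x \<in> X then \<xi> x else 0)"
  have \<xi>': "\<xi>' \<in> ell2 (source_fibre G u)" "ell2_norm (source_fibre G u) \<xi>' \<le> 1"
    unfolding \<xi>'_def by (rule ell2_restrict[OF \<xi>])+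
  have rep: "regular_rep G u h \<xi>' z = (\<Sum>x\<in>X. \<xi> x * h (mult G z (ginv G x)))" if "z \<in> F" for h z
  proof -
    have "regular_rep G u h \<xi>' z = (\<Sum>x\<in>X. \<xi>' x * h (mult G z (ginv G x)))"
      by (rule regular_rep_eq_sum[OF Fu[OF that] X]) (simp add: \<xi>'_def)
    then show ?thesis by (simp add: \<xi>'_def)
  qed
  have "regular_rep G u f \<xi> z = (\<Sum>x\<in>X. \<xi> x * f (mult G z (ginv G x)))" if "z \<in> F" for z
    by (rule regular_rep_eq_sum[OF Fu[OF that] X]) (use that in \<open>auto simp: X_def source_fibre_def\<close>)
  then have "c\<^sup>2 < (\<Sum>z\<in>F. (cmod (regular_rep G u f \<xi>' z))\<^sup>2)" using big by (simp add: rep)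
  then have bigL: "c < L2_set (\<lambda>z. cmod (regular_rep G u f \<xi>' z)) F"
    using c by (simp add: L2_set_def real_less_rsqrt)
  \<comment> \<open>Each of the \<open>card F * card X\<close> matrix entries of \<open>g\<close>
    gets an equal share of \<open>c / 2\<close>; the added ones keep the denominator
    positive.\<close>
  define \<kappa> where "\<kappa> = c / (2 * ((real (card F) + 1) * (real (card X) + 1)))"
  have nz: "0 < 2 * ((real (card F) + 1) * (real (card X) + 1))" by (intro mult_pos_pos) auto
  then have \<kappa>: "\<kappa> > 0" using c by (simp only: \<kappa>_def divide_pos_pos)
  show ?thesis
  proof (rule that[OF \<kappa>])
    fix g :: "'g \<Rightarrow> complex"
    assume g: "g \<in> Cc" and fg: "0 \<le> reduced_norm G (\<lambda>x. f x - g x)" "reduced_norm G (\<lambda>x. f x - g x) \<le> c / 2"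
    show "\<exists>x. \<kappa> \<le> cmod (g x)"
    proof (rule ccontr)
      assume "\<nexists>x. \<kappa> \<le> cmod (g x)"
      then have small: "cmod (g x) \<le> \<kappa>" for x by (meson less_imp_le not_le)
      have "cmod (regular_rep G u g \<xi>' z) \<le> card X * \<kappa>" if "z \<in> F" for z
      proof -
        have "cmod (regular_rep G u g \<xi>' z) \<le> (\<Sum>x\<in>X. 1 * \<kappa>)"
          unfolding rep[OF that]
          unfolding norm_mult by (intro sum_norm_le mult_mono[THEN order_trans[OF eq_refl[OF norm_mult]]] small ell2_coeff_le[OF \<xi>]) auto
        then show ?thesis by simp
      qed
      then have "(\<Sum>z\<in>F. cmod (regular_rep G u g \<xi>' z)) \<le> (\<Sum>z\<in>F. card X * \<kappa>)" by (rule sum_mono)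
      also have "\<dots> = (card F * card X) * \<kappa>" by simp
      also have "\<dots> \<le> ((real (card F) + 1) * (real (card X) + 1)) * \<kappa>"
        using \<kappa> unfolding of_nat_mult by (intro mult_right_mono mult_mono) auto
      also have "\<dots> = c / 2" 
        unfolding \<kappa>_def times_divide_eq_right mult.commute[of 2]
        using nz by (subst divide_divide_eq_left[symmetric]) simp
      finally have g2: "L2_set (\<lambda>z. cmod (regular_rep G u g \<xi>' z)) F \<le> c / 2"
        using L2_set_le_sum[of F "\<lambda>z. cmod (regular_rep G u g \<xi>' z)"] by simp
      have "(\<Sum>z\<in>F. (cmod (regular_rep G u (\<lambda>x. f x - g x) \<xi>' z))\<^sup>2) \<le> (reduced_norm G (\<lambda>x. f x - g x))\<^sup>2"
        by (rule finite_sum_le_reduced_norm[OF Cc_diff[OF f g] u \<xi>' F])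
      then have fg2: "L2_set (\<lambda>z. cmod (regular_rep G u (\<lambda>x. f x - g x) \<xi>' z)) F \<le> c / 2"
        using fg unfolding L2_set_def by (meson order_trans real_le_lsqrt)
      have "L2_set (\<lambda>z. cmod (regular_rep G u f \<xi>' z)) F
          \<le> L2_set (\<lambda>z. cmod (regular_rep G u (\<lambda>x. f x - g x) \<xi>' z) + cmod (regular_rep G u g \<xi>' z)) F"
      proof (rule L2_set_mono)
        fix z assume "z \<in> F"
        then have "regular_rep G u f \<xi>' z = regular_rep G u (\<lambda>x. f x - g x) \<xi>' z + regular_rep G u g \<xi>' z"
          by (simp add: rep right_diff_distrib flip: sum.distrib)
        then show "cmod (regular_rep G u f \<xi>' z)
            \<le> cmod (regular_rep G u (\<lambda>x. f x - g x) \<xi>' z) + cmod (regular_rep G u g \<xi>' z)"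
          by (simp add: norm_triangle_ineq)
      qed simp
      also have "\<dots> \<le> L2_set (\<lambda>z. cmod (regular_rep G u (\<lambda>x. f x - g x) \<xi>' z)) F
          + L2_set (\<lambda>z. cmod (regular_rep G u g \<xi>' z)) F" by (rule L2_set_triangle_ineq)
      finally show False using bigL g2 fg2 by simp
    qed
  qed
qed

end

section \<open>The reduced C*-algebra\<close>

locale reduced_groupoid_cstar = hausdorff_ample_groupoid G
  for G :: "'g::t2_space groupoid_data" +
  fixes \<iota> :: "('g \<Rightarrow> complex) \<Rightarrow> 'a::cstar_algebra"
  assumes reduced: "reduced_cstar_algebra G \<iota>"
begin

lemma iota_add: "f \<in> Cc \<Longrightarrow> g \<in> Cc \<Longrightarrow> \<iota> (\<lambda>x. f x + g x) = \<iota> f + \<iota> g"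
  and iota_scale: "f \<in> Cc \<Longrightarrow> \<iota> (\<lambda>x. c * f x) = c *\<^sub>C \<iota> f"
  and iota_mult: "f \<in> Cc \<Longrightarrow> g \<in> Cc \<Longrightarrow> \<iota> f * \<iota> g = \<iota> (convolution G f g)"
  and iota_star: "f \<in> Cc \<Longrightarrow> star (\<iota> f) = \<iota> (involution G f)"
  and norm_iota: "f \<in> Cc \<Longrightarrow> norm (\<iota> f) = reduced_norm G f"
  and iota_dense: "closure (\<iota> ` Cc) = UNIV"
  using reduced unfolding reduced_cstar_algebra_def by simp_all

lemma iota_diff:
  assumes "f \<in> Cc" "g \<in> Cc" shows "\<iota> (\<lambda>x. f x - g x) = \<iota> f - \<iota> g"
  using iota_add[OF assms(1) Cc_scale[OF assms(2), of "-1"]] iota_scale[OF assms(2), of "-1"]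
  by (simp add: scaleC_minus1)

lemma iota_approx:
  assumes "\<epsilon> > 0" obtains f where "f \<in> Cc" "norm (\<iota> f - x) < \<epsilon>"
proof -
  have "x \<in> closure (\<iota> ` Cc)" using iota_dense by simp
  then obtain y where "y \<in> \<iota> ` Cc" "dist y x < \<epsilon>" using assms unfolding closure_approachable by blast
  then show ?thesis using that by (auto simp: dist_norm)
qed

lemma cmod_le_norm_iota: "f \<in> Cc \<Longrightarrow> cmod (f x) \<le> norm (\<iota> f)"
  using cmod_le_reduced_norm[of f x] norm_ge_zero[of "\<iota> f"] by (simp add: norm_iota)

lemma iota_nonzero_coeff:
  assumes "x \<noteq> 0"
  obtains \<kappa> \<epsilon> where "\<kappa> > 0" "\<epsilon> > 0" "\<And>f. f \<in> Cc \<Longrightarrow> norm (\<iota> f - x) < \<epsilon> \<Longrightarrow> \<exists>y. \<kappa> \<le> cmod (f y)"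
proof -
  define c where "c = norm x"
  have c: "c > 0" using assms by (simp add: c_def)
  \<comment> \<open>Any two functions within \<open>c / 8\<close> of \<open>x\<close> differ by at
    most \<open>c / 4\<close>, half of the lower bound \<open>c / 2\<close> available for the norm
    of \<open>f\<close>.\<close>
  obtain f where f: "f \<in> Cc" "norm (\<iota> f - x) < c / 8" using iota_approx[of "c / 8" x] c by auto
  have "c - c / 8 < norm (\<iota> f)"
    using f(2) norm_triangle_ineq2[of x "\<iota> f"] by (simp add: c_def norm_minus_commute)
  then have "c / 2 < reduced_norm G f" using c f(1) by (simp flip: norm_iota)
  moreover have "0 < c / 2" using c by simp
  ultimately obtain \<kappa> where \<kappa>: "\<kappa> > 0"
    "\<And>g. g \<in> Cc \<Longrightarrow> 0 \<le> reduced_norm G (\<lambda>x. f x - g x) \<Longrightarrow> reduced_norm G (\<lambda>x. f x - g x) \<le> c / 2 / 2 \<Longrightarrow>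
      \<exists>x. \<kappa> \<le> cmod (g x)" using reduced_norm_faithful[OF f(1)] by blast
  show ?thesis
  proof (rule that[OF \<kappa>(1)])
    show "c / 8 > 0" using c by simp
    fix g assume g: "g \<in> Cc" "norm (\<iota> g - x) < c / 8"
    have "norm (\<iota> f - \<iota> g) \<le> norm (\<iota> f - x) + norm (\<iota> g - x)"
      using norm_triangle_ineq4[of "\<iota> f - x" "\<iota> g - x"] by simp
    then have "norm (\<iota> f - \<iota> g) \<le> c / 2 / 2" using f(2) g(2) by linarith
    moreover have "norm (\<iota> f - \<iota> g) = reduced_norm G (\<lambda>x. f x - g x)"
      using f(1) g(1) by (simp add: Cc_diff flip: iota_diff norm_iota)
    ultimately show "\<exists>y. \<kappa> \<le> cmod (g y)" using \<kappa>(2)[OF g(1)] by (metis norm_ge_zero)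
  qed
qed

lemma iota_approx_square:
  assumes "\<epsilon> > 0" "\<eta> > 0"
  obtains f where "f \<in> Cc" "norm (\<iota> f - x) < \<epsilon>"
    "norm (\<iota> (convolution G (involution G f) f) - star x * x) < \<eta>"
proof -
  have "((\<lambda>y. star y * y) \<longlongrightarrow> star x * x) (nhds x)"
    by (intro tendsto_mult bounded_linear.tendsto[OF bounded_linear_star] filterlim_ident)
  then have "eventually (\<lambda>y. norm (star y * y - star x * x) < \<eta>) (nhds x)"
    using assms(2) unfolding tendsto_iff dist_norm by blast
  then obtain d where d: "d > 0" "\<And>y. dist y x < d \<Longrightarrow> norm (star y * y - star x * x) < \<eta>"
    unfolding eventually_nhds_metric by blast
  obtain f where f: "f \<in> Cc" "norm (\<iota> f - x) < min \<epsilon> d" using iota_approx[of "min \<epsilon> d" x] assms d by auto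
  then have "norm (star (\<iota> f) * \<iota> f - star x * x) < \<eta>" by (intro d) (simp add: dist_norm)
  then show ?thesis using f by (intro that[of f]) (simp_all add: iota_star iota_mult Cc_involution)
qed

text \<open>This does the work of a faithful conditional expectation onto the diagonal: \<kappa> is
  fixed before \<eta>, so ever better approximants of \<open>star x * x\<close> keep a value at
  least \<kappa> at some unit.\<close>

lemma square_coeff:
  assumes "x \<noteq> 0"
  obtains \<kappa> where "\<kappa> > 0"
    "\<And>\<eta>. \<eta> > 0 \<Longrightarrow> \<exists>g\<in>Cc. \<exists>v\<in>units G. \<exists>r\<ge>\<kappa>. norm (\<iota> g - star x * x) < \<eta> \<and> g v = complex_of_real r"
proof -
  obtain \<kappa> \<epsilon> where \<kappa>: "\<kappa> > 0" and \<epsilon>: "\<epsilon> > 0"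
    and le: "\<And>f. f \<in> Cc \<Longrightarrow> norm (\<iota> f - x) < \<epsilon> \<Longrightarrow> \<exists>y. \<kappa> \<le> cmod (f y)"
    using iota_nonzero_coeff[OF assms] by blast
  show ?thesis
  proof (rule that)
    show "\<kappa>\<^sup>2 > 0" using \<kappa> by simp
    fix \<eta> :: real assume "\<eta> > 0"
    with \<epsilon> obtain f where f: "f \<in> Cc" "norm (\<iota> f - x) < \<epsilon>"
      "norm (\<iota> (convolution G (involution G f) f) - star x * x) < \<eta>"
      by (rule iota_approx_square)
    obtain y where y: "\<kappa> \<le> cmod (f y)" using le f by blast
    obtain r where r: "convolution G (involution G f) f (src G y) = complex_of_real r"
      "(cmod (f y))\<^sup>2 \<le> r"
      using convolution_involution_unit[OF f(1) src_unit[of y]] by metis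
    have "\<kappa>\<^sup>2 \<le> (cmod (f y))\<^sup>2" using y \<kappa> by (intro power_mono) auto
    then have "\<kappa>\<^sup>2 \<le> r" using r by simp
    then show "\<exists>g\<in>Cc. \<exists>v\<in>units G. \<exists>r\<ge>\<kappa>\<^sup>2. norm (\<iota> g - star x * x) < \<eta> \<and> g v = complex_of_real r"
      using f r src_unit Cc_convolution[OF Cc_involution[OF f(1)] f(1)] by blast
  qed
qed

text \<open>If \<open>w\<close> were nonzero, some approximant of its square would be at least
  \<kappa> at a unit \<open>v\<close>, where an approximant of the square of \<open>z\<close> is
  nonnegative. Their sum would have norm below \<kappa> but a value at least \<kappa> at
  \<open>v\<close>.\<close>

lemma sum_squares_eq_0:
  fixes w z :: 'a
  assumes "star w * w + star z * z = 0" shows "w = 0"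
proof (rule ccontr)
  assume "w \<noteq> 0"
  then obtain \<kappa> where \<kappa>: "\<kappa> > 0"
    "\<And>\<eta>. \<eta> > 0 \<Longrightarrow> \<exists>g\<in>Cc. \<exists>v\<in>units G. \<exists>r\<ge>\<kappa>. norm (\<iota> g - star w * w) < \<eta> \<and> g v = complex_of_real r"
    by (rule square_coeff) blast
  obtain g v r where g: "g \<in> Cc" "v \<in> units G" "\<kappa> \<le> r" "norm (\<iota> g - star w * w) < \<kappa> / 2" "g v = complex_of_real r"
    using \<kappa>(2)[of "\<kappa> / 2"] \<kappa>(1) by auto
  obtain f where f: "f \<in> Cc" "norm (\<iota> (convolution G (involution G f) f) - star z * z) < \<kappa> / 2"
    using iota_approx_square[of 1 "\<kappa> / 2" z] \<kappa>(1) by auto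
  let ?h = "convolution G (involution G f) f"
  have h: "?h \<in> Cc" by (intro Cc_convolution Cc_involution f)
  obtain s where s: "?h v = complex_of_real s" "s \<ge> 0"
    using convolution_involution_unit[OF f(1) g(2)] by metis
  have "norm (\<iota> (\<lambda>x. g x + ?h x)) = norm ((\<iota> g - star w * w) + (\<iota> ?h - star z * z))"
    using assms by (simp add: iota_add[OF g(1) h] algebra_simps)
  also have "\<dots> < \<kappa>" using norm_triangle_ineq[of "\<iota> g - star w * w" "\<iota> ?h - star z * z"] f(2) g(4) by linarith
  finally have "cmod (g v + ?h v) < \<kappa>"
    using cmod_le_norm_iota[OF Cc_add[OF g(1) h], of v] by simp
  moreover have "cmod (g v + ?h v) = r + s" using s g(3,5) \<kappa>(1) by (simp flip: of_real_add)
  ultimately show False using g(3) s(2) by simp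
qed

section \<open>Projections of compact open sets of units, and covering by minimality\<close>

definition proj :: "'g set \<Rightarrow> 'a" where
  "proj V = \<iota> (indicator V)"

lemma Cc_indicator_units: "compact_open_units V \<Longrightarrow> indicator V \<in> Cc"
  by (simp add: Cc_indicator compact_open_units_def)

lemma proj_empty [simp]: "proj {} = 0"
  using iota_scale[OF Cc_zero, of 0] by (simp add: proj_def indicator_def[abs_def])

lemma proj_mult_iota:
  assumes "compact_open_units V" "f \<in> Cc"
  shows "proj V * \<iota> f = \<iota> (\<lambda>x. indicator V (rng G x) * f x)"
    and "\<iota> f * proj V = \<iota> (\<lambda>x. f x * indicator V (src G x))"
  using assms by (simp_all add: proj_def iota_mult Cc_indicator_units convolution_indicator_left
      convolution_indicator_right compact_open_unitsD(4))

lemma proj_Int: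
  assumes "compact_open_units V" "compact_open_units W"
  shows "proj V * proj W = proj (V \<inter> W)"
proof -
  have "(\<lambda>x. indicator V (rng G x) * indicator W x) = (indicator (V \<inter> W) :: _ \<Rightarrow> complex)"
    using compact_open_unitsD(4)[OF assms(2)] by (auto simp: fun_eq_iff indicator_def)
  then show ?thesis
    using proj_mult_iota(1)[OF assms(1) Cc_indicator_units[OF assms(2)]] by (simp add: proj_def)
qed

lemma is_projection_proj:
  assumes "compact_open_units V" shows "is_projection (proj V)"
proof -
  have "star (proj V) = proj V"
    unfolding proj_def
    by (simp add: iota_star Cc_indicator_units assms involution_indicator_units compact_open_unitsD(4)[OF assms])
  then show ?thesis using proj_Int[OF assms assms] by (simp add: is_projection_def)
qed

lemma proj_Un:
  assumes "compact_open_units V" "compact_open_units W" "V \<inter> W = {}"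
  shows "proj (V \<union> W) = proj V + proj W"
proof -
  have "(indicator (V \<union> W) :: _ \<Rightarrow> complex) = (\<lambda>x. indicator V x + indicator W x)"
    using assms(3) by (auto simp: fun_eq_iff indicator_def)
  then show ?thesis by (simp add: proj_def iota_add Cc_indicator_units assms)
qed

lemma proj_nonzero:
  assumes "compact_open_units V" "V \<noteq> {}" shows "proj V \<noteq> 0"
proof -
  obtain v where "v \<in> V" using assms(2) by blast
  then show ?thesis
    using cmod_le_norm_iota[OF Cc_indicator_units[OF assms(1)], of v] by (auto simp: proj_def)
qed

text \<open>The ranges of the support fit into one compact open set of units. By density the
  projections then act as an approximate unit.\<close>

lemma iota_local_unit:
  assumes "f \<in> Cc"
  obtains V where "compact_open_units V" "proj V * \<iota> f = \<iota> f"
proof -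
  obtain K where K: "compact K" "\<And>x. x \<notin> K \<Longrightarrow> f x = 0" using CcE[OF assms] by metis
  obtain V where V: "compact_open_units V" "rng G ` K \<subseteq> V" using compact_open_units_cover[OF K(1)] by metis
  have "(\<lambda>x. indicator V (rng G x) * f x) = f" using K(2) V(2) by (force simp: fun_eq_iff indicator_def)
  then show ?thesis using V(1) proj_mult_iota(1)[OF V(1) assms] by (intro that[of V]) simp_all
qed

lemma bisection_conjugate:
  assumes B: "bisection B" and V: "compact_open_units V" "src G ` B \<subseteq> V"
  shows "\<iota> (indicator B) * proj V * star (\<iota> (indicator B)) = proj (rng G ` B)"
proof -
  have BC: "indicator B \<in> Cc" using B by (simp add: Cc_indicator bisection_def)
  have "(\<lambda>x. indicator B x * indicator V (src G x)) = (indicator B :: _ \<Rightarrow> complex)"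
    using V(2) by (auto simp: fun_eq_iff indicator_def)
  then have "\<iota> (indicator B) * proj V = \<iota> (indicator B)"
    using proj_mult_iota(2)[OF V(1) BC] by simp
  then show ?thesis
    by (simp add: iota_star iota_mult Cc_involution BC convolution_bisection_involution[OF B] proj_def)
qed

text \<open>The orbit of each \<open>w\<close> in \<open>W\<close> meets \<open>V\<close>, so some
  arrow from \<open>V\<close> to \<open>w\<close> exists and lies in a bisection with source in
  \<open>V\<close> and range in \<open>W\<close>. Compactness leaves finitely many of them. As an
  induction rule this serves both ideal membership and the construction of isometries.\<close>

lemma minimal_cover_induct [consumes 4, case_names empty Un]:
  assumes min: "minimal_groupoid G"
    and V: "compact_open_units V" "V \<noteq> {}" and W: "compact_open_units W"
    and empty: "Q {}"
    and step: "\<And>X B. compact_open_units X \<Longrightarrow> bisection B \<Longrightarrow> src G ` B \<subseteq> V \<Longrightarrow> X \<inter> rng G ` B = {} \<Longrightarrow>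
      Q X \<Longrightarrow> Q (X \<union> rng G ` B)"
  shows "Q W"
proof -
  define \<C> where "\<C> = {rng G ` B |B. bisection B \<and> src G ` B \<subseteq> V \<and> rng G ` B \<subseteq> W}"
  have "W \<subseteq> \<Union>\<C>"
  proof
    fix w assume w: "w \<in> W"
    then have wu: "w \<in> units G" using compact_open_unitsD(4)[OF W] by blast
    obtain v where v: "v \<in> V" using V by blast
    then have "v \<in> closure {rng G x | x. src G x = w}"
      using min wu compact_open_unitsD(4)[OF V(1)] unfolding minimal_groupoid_def by blast
    then obtain x where x: "src G x = w" "rng G x \<in> V"
      using compact_open_unitsD(2)[OF V(1)] v unfolding closure_iff_nhds_not_empty by blast
    have "open (src G -` V \<inter> rng G -` W)"
      using V W by (intro open_Int open_vimage_src open_vimage_rng compact_open_unitsD)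
    moreover have "ginv G x \<in> src G -` V \<inter> rng G -` W" using x w by (simp add: src_ginv rng_ginv)
    ultimately obtain B where "bisection B" "ginv G x \<in> B" "B \<subseteq> src G -` V \<inter> rng G -` W"
      using ample_basis by metis
    moreover have "w = rng G (ginv G x)" using x by (simp add: rng_ginv)
    ultimately show "w \<in> \<Union>\<C>" unfolding \<C>_def by blast
  qed
  moreover have "open C" if "C \<in> \<C>" for C
    using that by (auto simp: \<C>_def bisection_def open_rng_image)
  ultimately obtain \<D> where \<D>: "\<D> \<subseteq> \<C>" "finite \<D>" "W \<subseteq> \<Union>\<D>"
    using compactE[OF compact_open_unitsD(1)[OF W]] by metis
  have "compact_open_units (\<Union>\<D>) \<and> Q (\<Union>\<D>)"
    using \<D>(2,1)
  proof (induction \<D> rule: finite_induct)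
    case empty
    then show ?case using \<open>Q {}\<close> by simp
  next
    case (insert C \<D>)
    then obtain B where B: "C = rng G ` B" "bisection B" "src G ` B \<subseteq> V" by (auto simp: \<C>_def)
    have IH: "compact_open_units (\<Union>\<D>)" "Q (\<Union>\<D>)" using insert by auto
    \<comment> \<open>Only the arrows of \<open>B\<close> whose range is not yet covered are kept.
      The covered set is clopen, so a bisection remains and the union is disjoint.\<close>
    define B' where "B' = B \<inter> rng G -` (- \<Union>\<D>)"
    have "bisection B'" unfolding B'_def using compact_open_unitsD[OF IH(1)]
      by (intro bisection_subset B open_vimage_rng closed_vimage_rng) auto
    moreover have "src G ` B' \<subseteq> V" "\<Union>\<D> \<inter> rng G ` B' = {}" using B by (auto simp: B'_def)
    ultimately have "Q (\<Union>\<D> \<union> rng G ` B')" using IH by (intro step)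
    moreover have "\<Union>\<D> \<union> rng G ` B' = \<Union>(insert C \<D>)" by (auto simp: B'_def B(1))
    moreover have "compact_open_units (\<Union>(insert C \<D>))"
      using compact_open_units_Un[OF compact_open_units_rng[OF B(2)] IH(1)] by (simp add: B(1))
    ultimately show ?case by simp
  qed
  moreover have "\<Union>\<D> = W" using \<D> by (auto simp: \<C>_def)
  ultimately show ?thesis by simp
qed

text \<open>\<open>I\<close> is kept abstract because it is used both for a closed ideal and for the
  kernel of a character.\<close>

lemma proj_in_ideal:
  assumes min: "minimal_groupoid G"
    and V: "compact_open_units V" "V \<noteq> {}" and W: "compact_open_units W"
    and I: "0 \<in> I" "\<And>x y. x \<in> I \<Longrightarrow> y \<in> I \<Longrightarrow> x + y \<in> I" "\<And>a x b. x \<in> I \<Longrightarrow> a * x * b \<in> I" "proj V \<in> I"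
  shows "proj W \<in> I"
  using min V W
proof (induction rule: minimal_cover_induct)
  case empty
  then show ?case using I by simp
next
  case (Un X B)
  then show ?case
    using proj_Un[OF Un(1) compact_open_units_rng[OF Un(2)] Un(4)] I
      bisection_conjugate[OF Un(2) V(1) Un(3)] by metis
qed

section \<open>Compression to a diagonal projection, and absorption by infinite projections\<close>

lemma compress_to_proj:
  assumes tp: "topologically_principal G" and "x \<noteq> 0"
  obtains V v where "compact_open_units V" "V \<noteq> {}" "star v * (star x * x) * v = proj V"
proof -
  obtain \<kappa> where \<kappa>: "\<kappa> > 0"
    "\<And>\<eta>. \<eta> > 0 \<Longrightarrow> \<exists>g\<in>Cc. \<exists>v\<in>units G. \<exists>r\<ge>\<kappa>. norm (\<iota> g - star x * x) < \<eta> \<and> g v = complex_of_real r"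
    using square_coeff[OF assms(2)] by blast
  \<comment> \<open>One \<open>\<kappa> / 4\<close> pays for the approximation by \<open>g\<close>
    and another for the variation of \<open>g\<close> on \<open>V\<close>; their sum is at most
    \<open>3 / 4 * \<delta>\<close> because \<delta> is at least \<kappa>.\<close>
  obtain g u \<delta> where g: "g \<in> Cc" "u \<in> units G" "\<kappa> \<le> \<delta>" "norm (\<iota> g - star x * x) < \<kappa> / 4" "g u = complex_of_real \<delta>"
    using \<kappa>(2)[of "\<kappa> / 4"] \<kappa>(1) by auto
  define W where "W = {w. cmod (g w - complex_of_real \<delta>) < \<kappa> / 4} \<inter> units G"
  have "open {w. cmod (g w - complex_of_real \<delta>) < \<kappa> / 4}"
    by (intro open_Collect_less continuous_intros Cc_continuous g)
  then have W: "open W" "u \<in> W" using open_units g \<kappa>(1) by (auto simp: W_def)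
  define P where "P = {v \<in> units G. {y. rng G y = v \<and> src G y = v} = {v}}"
  have "u \<in> closure P"
    using tp g(2) unfolding topologically_principal_def P_def by (rule subsetD)
  then have "W \<inter> P \<noteq> {}" using W(2) open_Int_closure_eq_empty[OF W(1), of P] by blast
  then obtain w where "w \<in> W" "w \<in> P" by blast
  then have w: "w \<in> W" "{y. rng G y = w \<and> src G y = w} = {w}" by (simp_all only: P_def mem_Collect_eq)
  obtain K where K: "compact K" "\<And>y. y \<notin> K \<Longrightarrow> g y = 0" using CcE[OF g(1)] by metis
  \<comment> \<open>\<open>L\<close> records the ranges and sources of the nonunits in
    \<open>K\<close>. Trivial isotropy at \<open>w\<close> says that \<open>(w, w)\<close> lies
    outside this compact set, so a whole product neighbourhood does.\<close>
  define L where "L = (\<lambda>y. (rng G y, src G y)) ` (K \<inter> - units G)"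
  have "compact L" unfolding L_def
    by (intro compact_continuous_image continuous_on_Pair continuous_on_rng continuous_on_src
        compact_Int_closed K closed_Compl open_units)
  then have "open (- L)" by (simp add: compact_imp_closed open_Compl)
  moreover have "(w, w) \<in> - L"
  proof
    assume "(w, w) \<in> L"
    then obtain y where y: "y \<notin> units G" "rng G y = w" "src G y = w" by (auto simp: L_def)
    then have "y = w" using w(2) by blast
    then show False using y by (metis rng_unit)
  qed
  ultimately obtain A B where AB: "open A" "open B" "(w, w) \<in> A \<times> B" "A \<times> B \<subseteq> - L"
    by (rule open_prod_elim)
  obtain V where V: "compact_open_units V" "w \<in> V" "V \<subseteq> A \<inter> B \<inter> W"
    using compact_open_units_nbhd[of "A \<inter> B \<inter> W" w] AB W w by (auto simp: W_def)
  have pV: "is_projection (proj V)" using V(1) by (rule is_projection_proj)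
  define h where "h = (\<lambda>y. indicator V y * g y)"
  have h: "h \<in> Cc" unfolding h_def using compact_open_unitsD[OF V(1)] g
    by (intro Cc_mult_continuous continuous_on_indicator_clopen)
  \<comment> \<open>No nonunit in the support of \<open>g\<close> has both ends in \<open>V\<close>,
    so cutting down by \<open>proj V\<close> on both sides leaves only the values at units of
    \<open>V\<close>.\<close>
  have "indicator V (rng G y) * g y * indicator V (src G y) = h y" for y
  proof (cases "y \<in> units G")
    case False
    then have "y \<notin> V" using compact_open_unitsD(4)[OF V(1)] by blast
    moreover have "g y = 0" if "rng G y \<in> V" "src G y \<in> V"
    proof (rule ccontr)
      assume "g y \<noteq> 0"
      then have "(rng G y, src G y) \<in> L" using K(2) False by (auto simp: L_def)
      then show False using that V(3) AB(4) by blast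
    qed
    ultimately show ?thesis by (auto simp: h_def indicator_def)
  qed (auto simp: h_def indicator_def)
  moreover have "(\<lambda>y. indicator V (rng G y) * g y) \<in> Cc"
    using g compact_open_unitsD[OF V(1)]
    by (intro Cc_mult_continuous continuous_on_compose2[OF continuous_on_indicator_clopen continuous_on_rng]) auto
  ultimately have comp: "proj V * \<iota> g * proj V = \<iota> h"
    by (simp add: proj_mult_iota V(1) g(1))
  have "\<iota> h - \<delta> *\<^sub>R proj V = \<iota> (\<lambda>y. h y - complex_of_real \<delta> * indicator V y)"
    using h Cc_indicator_units[OF V(1)]
    by (simp add: iota_diff Cc_scale iota_scale proj_def scaleC_of_real)
  moreover have "norm (\<iota> (\<lambda>y. h y - complex_of_real \<delta> * indicator V y)) \<le> \<kappa> / 4"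
  proof (subst norm_iota)
    show "(\<lambda>y. h y - complex_of_real \<delta> * indicator V y) \<in> Cc"
      by (intro Cc_diff Cc_scale h Cc_indicator_units V)
    show "reduced_norm G (\<lambda>y. h y - complex_of_real \<delta> * indicator V y) \<le> \<kappa> / 4"
    proof (rule reduced_norm_supported_units)
      show "cmod (h y - complex_of_real \<delta> * indicator V y) \<le> \<kappa> / 4" for y
        using V(3) \<kappa>(1) by (auto simp: h_def indicator_def W_def)
      show "h y - complex_of_real \<delta> * indicator V y = 0" if "y \<notin> units G" for y
        using that compact_open_unitsD(4)[OF V(1)] by (auto simp: h_def indicator_def)
    qed
  qed
  moreover have "norm (proj V * (star x * x - \<iota> g) * proj V) \<le> 1 * norm (star x * x - \<iota> g) * 1"
    using norm_projection_le_1[OF pV]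
    by (intro norm_mult_ineq[THEN order_trans] mult_mono) auto
  moreover have "proj V * (star x * x) * proj V - \<delta> *\<^sub>R proj V
      = proj V * (star x * x - \<iota> g) * proj V + (\<iota> h - \<delta> *\<^sub>R proj V)"
    by (simp add: right_diff_distrib left_diff_distrib comp)
  ultimately have "norm (proj V * (star x * x) * proj V - \<delta> *\<^sub>R proj V) \<le> \<kappa> / 4 + \<kappa> / 4"
    using g(4) norm_triangle_ineq[of "proj V * (star x * x - \<iota> g) * proj V" "\<iota> h - \<delta> *\<^sub>R proj V"]
    by (simp add: norm_minus_commute)
  also have "\<dots> \<le> 3 / 4 * \<delta>" using g(3) \<kappa>(1) by simp
  finally have near: "norm (proj V * (star x * x) * proj V - \<delta> *\<^sub>R proj V) \<le> 3 / 4 * \<delta>" .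
  have "\<delta> > 0" "star (star x * x) = star x * x" using g(3) \<kappa>(1) by (simp_all add: star_mult star_star)
  with near obtain v where "star v * (star x * x) * v = proj V"
    using projection_compression[OF pV] by metis
  then show ?thesis using that[OF V(1)] V(2) by blast
qed

text \<open>The isometry \<open>t\<close> shifts \<open>p\<close> into itself, leaving room \<open>e = p - tt\<^sup>*\<close> for a copy of \<open>proj V\<close>;
  iterating, \<open>p\<close> has room for arbitrarily many copies, hence for every \<open>proj W\<close>.\<close>

lemma infinite_projection_absorbs:
  assumes tp: "topologically_principal G" and min: "minimal_groupoid G"
    and p: "infinite_projection p"
  obtains V e x where "compact_open_units V" "V \<noteq> {}" "proj V = star x * e * x"
    "\<And>\<phi>. algebra_character \<phi> \<Longrightarrow> \<phi> e = 0"
    "\<And>W. compact_open_units W \<Longrightarrow> \<exists>z. star z * p * z = proj W"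
proof -
  obtain t w where pp0: "is_projection p" and t: "t * star t * t = t" "star t * t = p" "t * star t \<noteq> p"
    and w: "p - t * star t = star w * w"
    using p unfolding infinite_projection_def partial_isometry_def positive_cone_def by blast
  note pp = is_projectionD[OF pp0]
  define q where "q = t * star t"
  \<comment> \<open>Formally \<open>m = star t (1 - p)\<close>. Its square and that of
    \<open>w (1 - p)\<close> add up to \<open>(1 - p) p (1 - p) = 0\<close>, which turns the order
    relation between \<open>t * star t\<close> and \<open>p\<close> into
    \<open>p * t = t\<close>.\<close>
  define m where "m = star t - star t * p"
  have 1: "star m * m = q - q * p - p * q + p * q * p"
    by (simp add: m_def q_def star_diff star_mult star_star pp algebra_simps)
  have 2: "star w * w = p - q" using w by (simp add: q_def)
  have "star (w - w * p) * (w - w * p) = star w * w - star w * w * p - p * (star w * w) + p * (star w * w) * p"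
    by (simp add: star_diff star_mult pp algebra_simps)
  then have "star m * m + star (w - w * p) * (w - w * p) = 0"
    unfolding 1 2 by (simp add: algebra_simps pp)
  then have "m = 0" by (rule sum_squares_eq_0)
  then have tp1: "star t * p = star t" by (simp add: m_def)
  have pt: "p * t = t" using arg_cong[OF tp1, of star] by (simp add: star_mult star_star pp)
  define e where "e = p - q"
  have sq: "star q = q" by (simp add: q_def star_mult star_star)
  have pq: "p * q = q" by (simp add: q_def pt flip: mult.assoc)
  have qp: "q * p = q" by (simp add: q_def tp1 mult.assoc)
  have qq: "q * q = q" by (simp add: q_def t(1) flip: mult.assoc)
  have e: "star e = e" "e * e = e" "p * e = e"
    using sq pq qp qq by (simp_all add: e_def star_diff pp algebra_simps)
  have et: "e * t = 0" using pt t(1) by (simp add: e_def q_def left_diff_distrib)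
  have te: "star t * e = 0" using arg_cong[OF et, of star] by (simp add: star_mult e)
  have "e \<noteq> 0" using t(3) by (simp add: e_def q_def)
  then obtain V x where V: "compact_open_units V" "V \<noteq> {}" and x: "star x * (star e * e) * x = proj V"
    using compress_to_proj[OF tp] by metis
  have x: "star x * e * x = proj V" using x e by simp
  show ?thesis
  proof (rule that[OF V x[symmetric]])
    fix \<phi> :: "'a \<Rightarrow> complex" assume "algebra_character \<phi>"
    then have \<phi>: "\<phi> (a + b) = \<phi> a + \<phi> b" "\<phi> (a * b) = \<phi> a * \<phi> b" for a b
      by (simp_all add: algebra_character_def)
    \<comment> \<open>A character takes the same value on \<open>p = star t * t\<close> and
      \<open>q = t * star t\<close>, so it vanishes on their difference.\<close>
    have "\<phi> (e + q) = \<phi> q" by (simp add: e_def q_def \<phi>(2) mult.commute flip: t(2))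
    then show "\<phi> e = 0" by (simp add: \<phi>(1))
  next
    fix W assume "compact_open_units W"
    have "\<exists>z. star z * z = proj W \<and> p * z = z"
      using min V \<open>compact_open_units W\<close>
    proof (induction rule: minimal_cover_induct)
      case empty
      then show ?case by (intro exI[of _ 0]) simp
    next
      case (Un X B)
      then obtain z where z: "star z * z = proj X" "p * z = z" by blast
      define y where "y = \<iota> (indicator B)"
      have y: "y * proj V * star y = proj (rng G ` B)"
        unfolding y_def by (rule bisection_conjugate[OF Un(2) V(1) Un(3)])
      \<comment> \<open>The copy of \<open>proj X\<close> built so far is shifted by
        \<open>t\<close>, which frees \<open>e\<close>; the new copy goes through \<open>e\<close>.
        The cross terms vanish because \<open>e * t = 0\<close>.\<close>
      define z' where "z' = t * z + e * x * star y"
      have "star z' * z' = star z * (star t * t) * z + star z * (star t * e) * x * star y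
          + y * star x * (e * t) * z + y * (star x * (e * e) * x) * star y"
        by (simp add: z'_def star_add star_mult star_star e(1) algebra_simps)
      also have "\<dots> = star z * (p * z) + y * (star x * e * x) * star y"
        by (simp add: t(2) te et e mult.assoc)
      also have "\<dots> = proj (X \<union> rng G ` B)"
        using proj_Un[OF Un(1) compact_open_units_rng[OF Un(2)] Un(4)] by (simp add: z x y)
      finally have "star z' * z' = proj (X \<union> rng G ` B)" .
      moreover have "p * z' = z'" by (simp add: z'_def distrib_left pt e flip: mult.assoc)
      ultimately show ?case by blast
    qed
    then show "\<exists>z. star z * p * z = proj W" by (metis mult.assoc)
  qed
qed

section \<open>From infinite projections to pure infiniteness\<close>

lemma purely_infiniteI:
  assumes tp: "topologically_principal G" and min: "minimal_groupoid G"
    and inf: "\<And>V. compact_open_units V \<Longrightarrow> V \<noteq> {} \<Longrightarrow>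
      \<exists>U\<subseteq>V. compact_open_units U \<and> infinite_projection (proj U)"
  shows "purely_infinite TYPE('a)"
proof -
  \<comment> \<open>An infinite \<open>proj U\<close> with \<open>U\<close> inside \<open>V\<close>
    absorbs \<open>proj W\<close> and is itself below \<open>proj V\<close>.\<close>
  have below: "proj W \<precsim> proj V"
    if V: "compact_open_units V" "V \<noteq> {}" and W: "compact_open_units W" for V W
  proof -
    obtain U where U: "U \<subseteq> V" "compact_open_units U" "infinite_projection (proj U)" using inf V by blast
    obtain z where "star z * proj U * z = proj W"
      using infinite_projection_absorbs[OF tp min U(3)] W by metis
    then have "proj W \<precsim> proj U" by (metis cuntz_below_compression)
    moreover have "star (proj U) * proj V * proj U = proj U"
      using U V(1) is_projectionD(1)[OF is_projection_proj[OF U(2)]]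
      by (simp add: proj_Int compact_open_units_Int Int_absorb2)
    then have "proj U \<precsim> proj V" by (metis cuntz_below_compression)
    ultimately show ?thesis by (rule cuntz_below_trans)
  qed
  have "a \<precsim> b" if a: "a \<in> positive_cone" and b: "b \<in> positive_cone" and ab: "a \<in> closed_ideal_generated b" for a b :: 'a
  proof (cases "b = 0")
    case True
    have "closed_two_sided_ideal {0 :: 'a}"
      unfolding closed_two_sided_ideal_def using norm_scaleC[of _ "0::'a"] by auto
    then have "a = 0" using ab True unfolding closed_ideal_generated_def by blast
    then show ?thesis using cuntz_below_compression[of 0 b] by simp
  next
    case False
    obtain x where x: "b = star x * x" using b unfolding positive_cone_def by blast
    then have "x \<noteq> 0" using False by auto
    then obtain V v where V: "compact_open_units V" "V \<noteq> {}" "star v * b * v = proj V"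
      using compress_to_proj[OF tp, of x] unfolding x by metis
    obtain y where y: "a = star y * y" using a unfolding positive_cone_def by blast
    show ?thesis
    proof (rule cuntz_below_closure)
      fix \<epsilon> :: real assume "\<epsilon> > 0"
      \<comment> \<open>The added 1 makes \<open>n\<close> positive and the final estimate
        strict.\<close>
      define n where "n = norm y + 1"
      define \<eta> where "\<eta> = \<epsilon> / (2 * n)"
      have n: "n > 0" unfolding n_def using norm_ge_zero[of y] by linarith
      have \<eta>: "\<eta> > 0" unfolding \<eta>_def using \<open>\<epsilon> > 0\<close> n by simp
      then obtain f where f: "f \<in> Cc" "norm (\<iota> f - y) < \<eta>" by (rule iota_approx)
      obtain W where W: "compact_open_units W" "proj W * \<iota> f = \<iota> f" using iota_local_unit[OF f(1)] by metis
      have "norm (proj W * (\<iota> f - y)) \<le> 1 * norm (\<iota> f - y)"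
        using norm_projection_le_1[OF is_projection_proj[OF W(1)]]
        by (intro norm_mult_ineq[THEN order_trans] mult_right_mono) auto
      \<comment> \<open>Since \<open>proj W\<close> fixes \<open>\<iota> f\<close>, this difference
        equals \<open>proj W * y - y\<close>.\<close>
      then have "norm ((\<iota> f - y) - proj W * (\<iota> f - y)) \<le> 2 * \<eta>"
        using f(2) norm_triangle_ineq4[of "\<iota> f - y" "proj W * (\<iota> f - y)"] by linarith
      then have "norm (proj W * y - y) \<le> 2 * \<eta>"
        using W(2) by (simp add: right_diff_distrib)
      then have "norm (star y * (proj W * y - y)) \<le> norm y * (2 * \<eta>)"
        by (intro norm_mult_ineq[THEN order_trans] mult_mono) auto
      also have "\<dots> < n * (2 * \<eta>)" using \<eta> by (simp add: n_def)
      also have "\<dots> = \<epsilon>" using n by (simp add: \<eta>_def)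
      finally have "norm (star y * proj W * y - a) < \<epsilon>" by (simp add: y right_diff_distrib mult.assoc)
      moreover have "star y * proj W * y \<precsim> b"
        using cuntz_below_trans[OF cuntz_below_compression cuntz_below_trans[OF below[OF V(1,2) W(1)]]]
          cuntz_below_compression[of v b] V(3) by metis
      ultimately show "\<exists>c. norm (c - a) < \<epsilon> \<and> c \<precsim> b" by blast
    qed
  qed
  \<comment> \<open>A character kills \<open>e\<close>, hence a nonzero \<open>proj V\<close>, hence
    by minimality every \<open>proj W\<close>. The local units then make it vanish on the dense
    image of \<open>Cc\<close>.\<close>
  moreover have "\<not> algebra_character \<phi>" for \<phi> :: "'a \<Rightarrow> complex"
  proof
    assume \<phi>: "algebra_character \<phi>"
    note \<phi>' = \<phi>[unfolded algebra_character_def]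
    obtain u where u: "u \<in> units G" using units_nonempty by blast
    obtain U0 where "compact_open_units U0" "u \<in> U0" by (rule compact_open_units_nbhd[OF open_UNIV UNIV_I u])
    then obtain U where U: "infinite_projection (proj U)" using inf by blast
    obtain V e x where V: "compact_open_units V" "V \<noteq> {}" "proj V = star x * e * x" "\<phi> e = 0"
      using infinite_projection_absorbs[OF tp min U] \<phi> by metis
    have W: "\<phi> (proj W) = 0" if "compact_open_units W" for W
    proof -
      have "\<phi> (0 *\<^sub>C 0) = 0 * \<phi> 0" using \<phi>' by blast
      then have "\<phi> 0 = 0" by simp
      moreover have "\<phi> (proj V) = 0" using \<phi>' V by simp
      ultimately have "proj W \<in> {a. \<phi> a = 0}"
        using \<phi>' by (intro proj_in_ideal[OF min V(1,2) that]) auto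
      then show ?thesis by simp
    qed
    obtain d where "d \<in> \<iota> ` Cc" "\<phi> d \<noteq> 0" using character_nonzero_on_dense[OF \<phi> iota_dense] by metis
    then obtain f where f: "f \<in> Cc" "\<phi> (\<iota> f) \<noteq> 0" by blast
    obtain W where "compact_open_units W" "proj W * \<iota> f = \<iota> f" using iota_local_unit[OF f(1)] by metis
    then have "\<phi> (\<iota> f) = 0" using \<phi>' W by (metis mult_zero_left)
    then show False using f(2) by simp
  qed
  ultimately show ?thesis
    unfolding purely_infinite_def using cuntz_below_imp_in_ideal by blast
qed

section \<open>From pure infiniteness to infinite projections\<close>

lemma purely_infinite_isometry:
  assumes pi: "purely_infinite TYPE('a)" and min: "minimal_groupoid G"
    and V: "compact_open_units V" "V \<noteq> {}" and W: "compact_open_units W"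
  obtains t where "star t * t = proj W" "proj V * t = t"
proof -
  note I = closed_two_sided_ideal_generated[of "proj V", unfolded closed_two_sided_ideal_def]
  have "proj V \<in> closed_ideal_generated (proj V)" by (auto simp: closed_ideal_generated_def)
  then have "proj W \<in> closed_ideal_generated (proj V)"
    using I by (intro proj_in_ideal[OF min V W]) blast+
  then show ?thesis
    using purely_infinite_below[OF pi is_projection_proj[OF W] is_projection_proj[OF V(1)]] that by blast
qed

text \<open>Compressing a function keeps only its values on arrows from \<open>u\<close> to
  \<open>u\<close>, that is, its value at \<open>u\<close>. The complex line spanned by the
  projection is complete, hence closed, so density carries this to every element.\<close>

lemma corner_of_isolated_unit:
  assumes U: "compact_open_units {u}" and iso: "{y. rng G y = u \<and> src G y = u} = {u}"
  obtains c where "proj {u} * a * proj {u} = c *\<^sub>C proj {u}"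
proof -
  let ?e = "proj {u}"
  define R where "R = range (\<lambda>c. c *\<^sub>C ?e)"
  have bl: "bounded_linear (\<lambda>c. c *\<^sub>C ?e)"
    by (rule bounded_linear_intro[where K="norm ?e"])
      (simp_all add: scaleC_add_left norm_scaleC scaleR_conv_of_real flip: scaleC_scaleC scaleC_of_real)
  have "complete R" unfolding R_def
    by (rule complete_isometric_image[of "norm ?e", OF _ subspace_UNIV bl])
      (use proj_nonzero[OF U] complete_UNIV in \<open>auto simp: norm_scaleC\<close>)
  then have "closed R" by (rule complete_imp_closed)
  then have "closed ((\<lambda>a. ?e * a * ?e) -` R)" by (intro closed_vimage continuous_intros)
  moreover have "\<iota> ` Cc \<subseteq> (\<lambda>a. ?e * a * ?e) -` R"
  proof safe
    fix f :: "'g \<Rightarrow> complex" assume f: "f \<in> Cc"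
    have "(\<lambda>y. indicator {u} (rng G y) * f y) \<in> Cc"
      using f compact_open_unitsD[OF U]
      by (intro Cc_mult_continuous continuous_on_compose2[OF continuous_on_indicator_clopen continuous_on_rng]) auto
    then have "?e * \<iota> f * ?e = \<iota> (\<lambda>y. indicator {u} (rng G y) * f y * indicator {u} (src G y))"
      using f U by (simp add: proj_mult_iota)
    also have "(\<lambda>y. indicator {u} (rng G y) * f y * indicator {u} (src G y)) = (\<lambda>y. f u * indicator {u} y)"
    proof
      fix y
      have "rng G y = u \<and> src G y = u \<longleftrightarrow> y = u" using iso by blast
      then show "indicator {u} (rng G y) * f y * indicator {u} (src G y) = f u * indicator {u} y"
        by (auto simp: indicator_def)
    qed
    also have "\<iota> \<dots> = f u *\<^sub>C ?e" by (simp add: iota_scale Cc_indicator_units U proj_def)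
    finally show "\<iota> f \<in> (\<lambda>a. ?e * a * ?e) -` R" by (simp add: R_def)
  qed
  ultimately have "closure (\<iota> ` Cc) \<subseteq> (\<lambda>a. ?e * a * ?e) -` R" by (rule closure_minimal[rotated])
  then have "?e * a * ?e \<in> R" using iota_dense by auto
  then show ?thesis using that by (auto simp: R_def)
qed

text \<open>With \<open>u\<close> as the only unit, its projection is a unit of the algebra and the
  corner is everything. The coefficient in this one-dimensional algebra is multiplicative.\<close>

lemma trivial_groupoid_character:
  assumes U: "compact_open_units {u}" and iso: "{y. rng G y = u \<and> src G y = u} = {u}"
    and units: "units G = {u}"
  obtains \<phi> :: "'a \<Rightarrow> complex" where "algebra_character \<phi>"
proof -
  let ?e = "proj {u}"
  have ru: "rng G y = u" "src G y = u" for y using units rng_unit src_unit by blast+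
  have "closed {a. ?e * a = a \<and> a * ?e = a}"
    by (intro closed_Collect_conj closed_Collect_eq continuous_intros)
  moreover have "\<iota> ` Cc \<subseteq> {a. ?e * a = a \<and> a * ?e = a}"
    using U by (auto simp: proj_mult_iota ru)
  ultimately have "closure (\<iota> ` Cc) \<subseteq> {a. ?e * a = a \<and> a * ?e = a}" by (rule closure_minimal[rotated])
  then have unit: "?e * a = a" "a * ?e = a" for a using iota_dense by auto
  have "\<exists>c. a = c *\<^sub>C ?e" for a
    using corner_of_isolated_unit[OF U iso, of a] unit by metis
  then obtain \<phi> where \<phi>: "\<And>a. a = \<phi> a *\<^sub>C ?e" by metis
  have uniq: "\<phi> a = c" if "a = c *\<^sub>C ?e" for a c
  proof -
    have "(\<phi> a - c) *\<^sub>C ?e = \<phi> a *\<^sub>C ?e - c *\<^sub>C ?e"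
      using scaleC_add_left[of "\<phi> a - c" c ?e] by simp
    also have "\<dots> = 0" using \<phi>[of a] that by simp
    finally have "cmod (\<phi> a - c) * norm ?e = 0" by (metis norm_scaleC norm_zero)
    then show ?thesis using proj_nonzero[OF U] by simp
  qed
  have "algebra_character \<phi>"
    unfolding algebra_character_def
  proof (intro conjI allI)
    show "\<phi> (x + y) = \<phi> x + \<phi> y" for x y
      by (rule uniq) (use \<phi>[of x] \<phi>[of y] in \<open>simp add: scaleC_add_left\<close>)
    show "\<phi> (c *\<^sub>C x) = c * \<phi> x" for c x
      by (rule uniq) (use \<phi>[of x] in \<open>simp flip: scaleC_scaleC\<close>)
    show "\<phi> (x * y) = \<phi> x * \<phi> y" for x y
    proof (rule uniq)
      have "x * y = (\<phi> x *\<^sub>C ?e) * (\<phi> y *\<^sub>C ?e)" using \<phi>[of x] \<phi>[of y] by simp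
      then show "x * y = (\<phi> x * \<phi> y) *\<^sub>C ?e"
        by (simp add: mult_scaleC_left mult_scaleC_right scaleC_scaleC unit mult.commute)
    qed
    have "\<phi> ?e = 1" by (rule uniq) simp
    then show "\<exists>x. \<phi> x \<noteq> 0" by (metis zero_neq_one)
  qed
  then show ?thesis by (rule that)
qed

lemma infinite_projection_proj:
  assumes pi: "purely_infinite TYPE('a)"
    and tp: "topologically_principal G" and min: "minimal_groupoid G"
    and U: "compact_open_units U" "U \<noteq> {}"
  shows "infinite_projection (proj U)"
proof (cases "\<exists>V. compact_open_units V \<and> V \<noteq> {} \<and> V \<subset> U")
  case True
  then obtain V where V: "compact_open_units V" "V \<noteq> {}" "V \<subset> U" by blast
  obtain t where t: "star t * t = proj U" "proj V * t = t"
    using purely_infinite_isometry[OF pi min V(1,2) U(1)] by metis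
  \<comment> \<open>\<open>proj (U - V)\<close> serves as the witness of properness: it is
    orthogonal to the range of \<open>t\<close> and lies below \<open>proj U\<close>.\<close>
  have UV: "compact_open_units (U - V)" by (intro compact_open_units_Diff U V)
  have "(U - V) \<inter> V = {}" "(U - V) \<inter> U = U - V" "U \<inter> V = V" using V(3) by auto
  then have proj: "proj (U - V) * proj V = 0" "proj (U - V) * proj U = proj (U - V)" "proj U * proj V = proj V"
    by (simp_all add: proj_Int U V UV)
  show ?thesis
  proof (rule infinite_projectionI[OF is_projection_proj[OF U(1)] t(1)])
    show "proj U * t = t" using t(2) proj(3) by (metis mult.assoc)
    show "proj (U - V) * t = 0" using t(2) proj(1) by (metis mult.assoc mult_zero_left)
    show "proj (U - V) * proj U \<noteq> 0" using proj(2) proj_nonzero[OF UV] V(3) by auto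
  qed
next
  case False
  obtain u where u: "u \<in> U" using U(2) by blast
  \<comment> \<open>Two points of \<open>U\<close> could be separated by a compact open subset,
    which would be nonempty and proper.\<close>
  have "v = u" if v: "v \<in> U" for v
  proof (rule ccontr)
    assume "v \<noteq> u"
    have "open (U - {v})" using compact_open_unitsD(2)[OF U(1)] by (simp add: open_delete)
    then obtain V where "compact_open_units V" "u \<in> V" "V \<subseteq> U - {v}"
      using compact_open_units_nbhd[of "U - {v}" u] u \<open>v \<noteq> u\<close> compact_open_unitsD(4)[OF U(1)] by blast
    then show False using False v by blast
  qed
  then have Uu: "U = {u}" using u by blast
  have cu: "compact_open_units {u}" using U(1) Uu by simp
  \<comment> \<open>The point \<open>u\<close> is isolated, so lying in the closure of the units
    with trivial isotropy it is one of them.\<close>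
  have "u \<in> closure {u \<in> units G. {x. rng G x = u \<and> src G x = u} = {u}}"
    using tp compact_open_unitsD(4)[OF cu] unfolding topologically_principal_def by blast
  then have iso: "{y. rng G y = u \<and> src G y = u} = {u}"
    using compact_open_unitsD(2)[OF cu] unfolding closure_iff_nhds_not_empty by blast
  have "units G \<noteq> {u}"
    using trivial_groupoid_character[OF cu iso] pi unfolding purely_infinite_def by blast
  then obtain v where v: "v \<in> units G" "v \<noteq> u" using compact_open_unitsD(4)[OF cu] by blast
  obtain V0 where V0: "compact_open_units V0" "v \<in> V0" by (rule compact_open_units_nbhd[OF open_UNIV UNIV_I v(1)])
  \<comment> \<open>A second unit gives \<open>W\<close> strictly larger than the singleton,
    although pure infiniteness embeds \<open>proj W\<close> into the one-dimensional corner at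
    \<open>u\<close>.\<close>
  define V where "V = V0 - {u}"
  have V: "compact_open_units V" "v \<in> V" "u \<notin> V"
    using compact_open_units_Diff[OF V0(1) cu] V0 v by (auto simp: V_def)
  define W where "W = insert u V"
  have W: "compact_open_units W" using compact_open_units_Un[OF cu V(1)] by (simp add: W_def)
  obtain t where t: "star t * t = proj W" "proj {u} * t = t"
    using purely_infinite_isometry[OF pi min cu _ W] by blast
  obtain \<alpha> where "proj {u} * t * proj {u} = \<alpha> *\<^sub>C proj {u}"
    by (rule corner_of_isolated_unit[OF cu iso])
  then have \<alpha>: "t * proj {u} = \<alpha> *\<^sub>C proj {u}" using t(2) by simp
  have "W \<inter> {u} = {u}" "V \<inter> {u} = {}" "V \<inter> W = V" using V by (auto simp: W_def)
  then have proj: "proj W * proj {u} = proj {u}" "proj V * proj {u} = 0" "proj V * proj W = proj V"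
    by (simp_all add: proj_Int V W cu)
  have st: "star t * proj {u} = star t"
    using arg_cong[OF t(2), of star] is_projectionD(1)[OF is_projection_proj[OF cu]] by (simp add: star_mult)
  \<comment> \<open>Here \<open>star t\<close> turns out to be a multiple of
    \<open>proj {u}\<close>, so \<open>proj V\<close> annihilates it. Then
    \<open>proj V = proj V * (star t * t) = 0\<close>, a contradiction.\<close>
  have "proj {u} = star t * (t * proj {u})" using proj(1) t(1) by (simp flip: mult.assoc)
  also have "\<dots> = \<alpha> *\<^sub>C star t" by (simp add: \<alpha> mult_scaleC_right st)
  finally have e: "proj {u} = \<alpha> *\<^sub>C star t" .
  then have "\<alpha> \<noteq> 0" using proj_nonzero[OF cu] by auto
  have "\<alpha> *\<^sub>C (proj V * star t) = 0" using proj(2) e by (simp flip: mult_scaleC_right)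
  then have "proj V * star t = 0" using \<open>\<alpha> \<noteq> 0\<close> by (metis mult_eq_0_iff norm_eq_zero norm_scaleC)
  then have "proj V * (star t * t) = 0" by (simp flip: mult.assoc)
  then have "proj V = 0" by (simp add: t(1) proj(3))
  then show ?thesis using proj_nonzero[OF V(1)] V(2) by auto
qed

section \<open>Projections in the diagonal as indicator functions\<close>

lemma function_projection_eq_indicator:
  assumes p: "p \<in> C0 (units G)" "function_projection (units G) p"
  defines "U \<equiv> function_support (units G) p"
  shows "extend_by_zero (units G) p = indicator U" "U = {x \<in> units G. p x \<noteq> 0}"
proof -
  have p01: "p x = 0 \<or> p x = 1" if "x \<in> units G" for x
  proof -
    have "p x * p x = p x" using p(2) that by (simp add: function_projection_def)
    then have "p x * (p x - 1) = 0" by (simp add: right_diff_distrib)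
    then show ?thesis by simp
  qed
  \<comment> \<open>The values are only 0 and 1, so the nonvanishing set is a level set, already
    closed in the unit space.\<close>
  then have eq: "{x \<in> units G. p x \<noteq> 0} = {x \<in> units G. p x = 1}" by auto
  have "closedin (top_of_set (units G)) {x \<in> units G. p x = 1}"
    using p(1) by (intro continuous_closedin_preimage_constant) (simp add: C0_def)
  then show U: "U = {x \<in> units G. p x \<noteq> 0}"
    unfolding U_def function_support_def eq by (simp add: closure_of_closedin)
  show "extend_by_zero (units G) p = indicator U"
    using p01 by (auto simp: U extend_by_zero_def indicator_def fun_eq_iff)
qed

lemma indicator_function_projection:
  assumes U: "compact_open_units U"
  shows "indicator U \<in> C0 (units G)" "function_projection (units G) (indicator U)"
    "function_support (units G) (indicator U) = U"
proof -
  note U' = compact_open_unitsD[OF U]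
  have "compact {x \<in> units G. \<epsilon> \<le> cmod (indicator U x)}" if "\<epsilon> > 0" for \<epsilon> :: real
  proof (cases "\<epsilon> \<le> 1")
    case True
    then have "{x \<in> units G. \<epsilon> \<le> cmod (indicator U x)} = U" using that U' by (auto simp: indicator_def)
    then show ?thesis using U' by simp
  next
    case False
    then have "{x \<in> units G. \<epsilon> \<le> cmod (indicator U x)} = {}" by (auto simp: indicator_def)
    then show ?thesis by (simp only: compact_empty)
  qed
  then show C0: "indicator U \<in> C0 (units G)" unfolding C0_def
    using continuous_on_indicator_clopen[OF U'(2,3)] by simp
  show fp: "function_projection (units G) (indicator U)" by (simp add: function_projection_def indicator_def)
  show "function_support (units G) (indicator U) = U"
    using function_projection_eq_indicator(2)[OF C0 fp] U' by (auto simp: indicator_def)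
qed

end

theorem theorem4p1:
  fixes G :: "'g::{second_countable_topology, t2_space} groupoid_data"
    and \<B> :: "'g set set"
    and \<iota> :: "('g \<Rightarrow> complex) \<Rightarrow> 'a::cstar_algebra"
  assumes "ample_groupoid G"
    and "topologically_principal G"
    and "minimal_groupoid G"
    and "compact_open_unit_basis G \<B>"
    and "reduced_cstar_algebra G \<iota>"
  shows "purely_infinite TYPE('a) \<longleftrightarrow>
    (\<forall>p\<in>C0 (units G). function_projection (units G) p \<and> (\<exists>u\<in>units G. p u \<noteq> 0)
        \<and> function_support (units G) p \<in> \<B>
      \<longrightarrow> infinite_projection (\<iota> (extend_by_zero (units G) p)))"
proof -
  interpret ample_groupoid G by fact
  interpret reduced_groupoid_cstar G \<iota> by unfold_locales fact
  have B: "compact_open_units U" if "U \<in> \<B>" for U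
  proof -
    have "(arbitrary union_of (\<lambda>U. U \<in> \<B>)) U" using that by (simp add: arbitrary_union_of_inc)
    then show ?thesis using that assms(4)
      by (simp add: compact_open_unit_basis_def compact_open_units_def flip: openin_units_iff)
  qed
  show ?thesis
  proof (intro iffI ballI impI)
    fix p assume pi: "purely_infinite TYPE('a)" and p: "p \<in> C0 (units G)"
      and *: "function_projection (units G) p \<and> (\<exists>u\<in>units G. p u \<noteq> 0) \<and> function_support (units G) p \<in> \<B>"
    let ?U = "function_support (units G) p"
    have "?U \<noteq> {}" using function_projection_eq_indicator(2)[OF p] * by auto
    then have "infinite_projection (proj ?U)" using * B by (intro infinite_projection_proj pi assms) auto
    then show "infinite_projection (\<iota> (extend_by_zero (units G) p))"
      using function_projection_eq_indicator(1)[OF p] * by (simp add: proj_def)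
  next
    assume inf: "\<forall>p\<in>C0 (units G). function_projection (units G) p \<and> (\<exists>u\<in>units G. p u \<noteq> 0)
        \<and> function_support (units G) p \<in> \<B> \<longrightarrow> infinite_projection (\<iota> (extend_by_zero (units G) p))"
    show "purely_infinite TYPE('a)"
    proof (rule purely_infiniteI[OF assms(2,3)])
      fix V assume V: "compact_open_units V" "V \<noteq> {}"
      then have "openin (top_of_set (units G)) V" by (simp add: openin_units_iff compact_open_unitsD)
      then have "(arbitrary union_of (\<lambda>U. U \<in> \<B>)) V"
        using assms(4) unfolding compact_open_unit_basis_def by metis
      \<comment> \<open>A nonempty \<open>V\<close> is a union of basis sets and so contains a
        nonempty one; the hypothesis reaches it through its indicator.\<close>
      then obtain \<U> where "\<U> \<subseteq> \<B>" "\<Union>\<U> = V" by (auto simp: union_of_def arbitrary_def)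
      then obtain U where U: "U \<in> \<B>" "U \<subseteq> V" "U \<noteq> {}" using V(2) by blast
      note U' = B[OF U(1)]
      note ind = indicator_function_projection[OF U']
      have "\<exists>u\<in>units G. (indicator U u :: complex) \<noteq> 0"
        using U(3) compact_open_unitsD(4)[OF U'] by (auto simp: indicator_def)
      then have "infinite_projection (\<iota> (extend_by_zero (units G) (indicator U)))"
        using inf ind U(1) by (metis (no_types, lifting))
      then have "infinite_projection (proj U)"
        using function_projection_eq_indicator(1)[OF ind(1,2)] ind(3) by (simp add: proj_def)
      then show "\<exists>U\<subseteq>V. compact_open_units U \<and> infinite_projection (proj U)" using U U' by blast
    qed
  qed
qed

end
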